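(* Let $\mu=(\mu_1,\dots,\mu_\ell)$ be a partition of length $\ell\ge2$ and let $k_1,\dots,k_{\ell-1}$ be positive integers with $k_c\le\mu_{c+1}$ for $c=1,\dots,\ell-1$. Suppose $n\ge|\mu|=\mu_1+\dots+\mu_\ell$. If $\mu_c>\mu_{c+1}$ for every $c$ such that $k_c=\mu_{c+1}>1$, then the cokernel of \[\sum_{c=1}^{\ell-1}\overline{\gamma}_{k_c}:\bigoplus_{c=1}^{\ell-1}\Lambda^{\mu_1}\otimes\cdots\otimes\Lambda^{\mu_c}\otimes\Lambda^{k_c}\otimes\Lambda^{\mu_{c+1}-k_c}\otimes\cdots\otimes\Lambda^{\mu_\ell}\to\Lambda^\mu\] is isomorphic to $L_\mu$.
   Context: $K$ is a field of characteristic zero, $G=GL(n,K)$, $V=K^n$, $\Lambda=\bigoplus_i\Lambda^i$ the exterior algebra of $V$. $m$ denotes multiplication in $\Lambda$ and $\Delta_{s,t}:\Lambda^{s+t}\to\Lambda^s\otimes\Lambda^t$ the component of the comultiplication, $v_1\cdots v_{s+t}\mapsto\sum_\sigma\mathrm{sgn}(\sigma)v_{\sigma(1)}\cdots v_{\sigma(s)}\otimes v_{\sigma(s+1)}\cdots v_{\sigma(s+t)}$ over permutations increasing on $\{1..s\}$ and on $\{s+1..s+t\}$. $\Lambda^\mu=\Lambda^{\mu_1}\otimes\cdots\otimes\Lambda^{\mu_\ell}$. For $a\ge b\ge k\ge1$, $\beta_k:\Lambda^a\otimes\Lambda^k\otimes\Lambda^{b-k}\to\Lambda^a\otimes\Lambda^b$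 is the composition $(m\otimes m)\circ(1\otimes\tau\otimes1)\circ(\Delta_{a-k,k}\otimes1)$, where $\tau:\Lambda^k\otimes\Lambda^k\to\Lambda^k\otimes\Lambda^k$, $w\otimes z\mapsto z\otimes w$; and $\gamma_k(x\otimes y\otimes z)=x\otimes yz-\beta_k(x\otimes y\otimes z)$. For each $c$, $\gamma_{k_c}$ is this map with $a=\mu_c$, $b=\mu_{c+1}$, $k=k_c$, and $\overline{\gamma}_{k_c}=1\otimes\cdots\otimes1\otimes\gamma_{k_c}\otimes1\otimes\cdots\otimes1$ (identity on the other factors). $L_\mu$ is the Schur module of $G$ indexed by $\mu$ (irreducible polynomial module of highest weight $\mu'$), equivalently the cokernel of $\theta_\mu=\sum_{c=1}^{\ell-1}1\otimes\cdots\otimes\theta_1\otimes\cdots\otimes1:\bigoplus_{c}\Lambda^{\mu_1}\otimes\cdots\otimes\Lambda^{\mu_c+1}\otimes\Lambda^{\mu_{c+1}-1}\otimes\cdots\otimes\Lambda^{\mu_\ell}\to\Lambda^\mu$, where $\theta_1=(1\otimes m)\circ(\Delta_{s-1,1}\otimes1):\Lambda^{s}\otimes\Lambda^{t}\to\Lambda^{s-1}\otimes\Lambda^{t+1}$. *)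

theory Defs
  imports Main "Jordan_Normal_Form.Determinant"
begin

(* Exterior algebra of V = K^n: an element is a coefficient function on finite
   subsets S of {0..<n}; S stands for the basis vector e_{s1}...e_{sk}, s1<...<sk. *)

definition sgn2 :: "nat set \<Rightarrow> nat set \<Rightarrow> 'a::comm_ring_1" where
  "sgn2 S T = (-1) ^ card {(s,t). s \<in> S \<and> t \<in> T \<and> t < s}"

definition ebas :: "nat set \<Rightarrow> nat set \<Rightarrow> 'a::comm_ring_1" where
  "ebas S = (\<lambda>U. if U = S then 1 else 0)"

definition wedge :: "(nat set \<Rightarrow> 'a::comm_ring_1) \<Rightarrow> (nat set \<Rightarrow> 'a) \<Rightarrow> nat set \<Rightarrow> 'a" where
  "wedge x y = (\<lambda>U. \<Sum>S\<in>Pow U. sgn2 S (U - S) * x S * y (U - S))"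

(* tensors in Lambda^{nu_1} (x) ... (x) Lambda^{nu_l}: coefficient functions on
   lists of index sets; bidx n nu is the standard basis index set *)
definition bidx :: "nat \<Rightarrow> nat list \<Rightarrow> nat set list set" where
  "bidx n \<nu> = {I. length I = length \<nu> \<and>
      (\<forall>j<length \<nu>. I ! j \<subseteq> {..<n} \<and> card (I ! j) = \<nu> ! j)}"

definition tspace :: "nat \<Rightarrow> nat list \<Rightarrow> (nat set list \<Rightarrow> 'a::comm_ring_1) set" where
  "tspace n \<nu> = {x. \<forall>I. x I \<noteq> 0 \<longrightarrow> I \<in> bidx n \<nu>}"

definition ptensor :: "(nat set \<Rightarrow> 'a::comm_ring_1) list \<Rightarrow> nat set list \<Rightarrow> 'a" where
  "ptensor xs = (\<lambda>I. if length I = length xs then \<Prod>j<length xs. (xs ! j) (I ! j) else 0)"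

definition lin :: "nat \<Rightarrow> nat list \<Rightarrow> (nat set list \<Rightarrow> nat set list \<Rightarrow> 'a::comm_ring_1)
    \<Rightarrow> (nat set list \<Rightarrow> 'a) \<Rightarrow> nat set list \<Rightarrow> 'a" where
  "lin n \<nu> F x = (\<lambda>J. \<Sum>I\<in>bidx n \<nu>. x I * F I J)"

(* gamma_k on the basis at positions c, c+1, c+2 (0-based), identity elsewhere:
   x (x) y (x) z |-> x (x) yz - sum_{Delta_{a-k,k} x = sum x1 (x) x2} x1 y (x) x2 z *)
definition gamma_basis :: "nat \<Rightarrow> nat \<Rightarrow> nat set list \<Rightarrow> nat set list \<Rightarrow> 'a::comm_ring_1" where
  "gamma_basis k c I = (let pre = map ebas (take c I); suf = map ebas (drop (c+3) I);
      A = I ! c; B = I ! (c+1); C = I ! (c+2) in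
    (\<lambda>J. ptensor (pre @ [ebas A, wedge (ebas B) (ebas C)] @ suf) J
       - (\<Sum>S\<in>{S. S \<subseteq> A \<and> card S = card A - k}.
            sgn2 S (A - S) *
            ptensor (pre @ [wedge (ebas S) (ebas B), wedge (ebas (A - S)) (ebas C)] @ suf) J)))"

definition gsrc :: "nat list \<Rightarrow> nat list \<Rightarrow> nat \<Rightarrow> nat list" where
  "gsrc \<mu> k c = take c \<mu> @ [\<mu> ! c, k ! c, \<mu> ! (c+1) - k ! c] @ drop (c+2) \<mu>"

definition gamma_map :: "nat \<Rightarrow> nat list \<Rightarrow> nat list \<Rightarrow> nat
    \<Rightarrow> (nat set list \<Rightarrow> 'a::comm_ring_1) \<Rightarrow> nat set list \<Rightarrow> 'a" where
  "gamma_map n \<mu> k c = lin n (gsrc \<mu> k c) (gamma_basis (k ! c) c)"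

definition gamma_image :: "nat \<Rightarrow> nat list \<Rightarrow> nat list \<Rightarrow> (nat set list \<Rightarrow> 'a::comm_ring_1) set" where
  "gamma_image n \<mu> k = {(\<lambda>J. \<Sum>c<length \<mu> - 1. gamma_map n \<mu> k c (x c) J) | x.
      \<forall>c<length \<mu> - 1. x c \<in> tspace n (gsrc \<mu> k c)}"

(* theta_1 = (1 (x) m)(Delta_{s-1,1} (x) 1) at positions c, c+1 *)
definition theta_basis :: "nat \<Rightarrow> nat set list \<Rightarrow> nat set list \<Rightarrow> 'a::comm_ring_1" where
  "theta_basis c I = (let pre = map ebas (take c I); suf = map ebas (drop (c+2) I);
      A = I ! c; B = I ! (c+1) in
    (\<lambda>J. \<Sum>S\<in>{S. S \<subseteq> A \<and> card S = card A - 1}.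
            sgn2 S (A - S) * ptensor (pre @ [ebas S, wedge (ebas (A - S)) (ebas B)] @ suf) J))"

definition tsrc :: "nat list \<Rightarrow> nat \<Rightarrow> nat list" where
  "tsrc \<mu> c = take c \<mu> @ [\<mu> ! c + 1, \<mu> ! (c+1) - 1] @ drop (c+2) \<mu>"

definition theta_image :: "nat \<Rightarrow> nat list \<Rightarrow> (nat set list \<Rightarrow> 'a::comm_ring_1) set" where
  "theta_image n \<mu> = {(\<lambda>J. \<Sum>c<length \<mu> - 1. lin n (tsrc \<mu> c) (theta_basis c) (x c) J) | x.
      \<forall>c<length \<mu> - 1. x c \<in> tspace n (tsrc \<mu> c)}"

(* GL(n,K)-action: g e_j = sum_i g_{ij} e_i, extended multiplicatively to Lambda
   and factorwise to tensor products *)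
definition gvec :: "nat \<Rightarrow> 'a::comm_ring_1 mat \<Rightarrow> nat \<Rightarrow> nat set \<Rightarrow> 'a" where
  "gvec n g j = (\<lambda>U. if \<exists>i<n. U = {i} then g $$ (the_elem U, j) else 0)"

definition act_basis :: "nat \<Rightarrow> 'a::comm_ring_1 mat \<Rightarrow> nat set \<Rightarrow> nat set \<Rightarrow> 'a" where
  "act_basis n g S = foldr (\<lambda>j acc. wedge (gvec n g j) acc) (sorted_list_of_set S) (ebas {})"

definition gact :: "nat \<Rightarrow> nat list \<Rightarrow> 'a::comm_ring_1 mat
    \<Rightarrow> (nat set list \<Rightarrow> 'a) \<Rightarrow> nat set list \<Rightarrow> 'a" where
  "gact n \<nu> g x = lin n \<nu> (\<lambda>I. ptensor (map (act_basis n g) I)) x"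

(* Lambda^mu / W1 and Lambda^mu / W2 are isomorphic as GL(n,K)-modules, expressed via
   a K-linear map phi on Lambda^mu inducing a bijection of the quotients which is
   G-equivariant modulo W2 *)
definition G_iso_quot :: "nat \<Rightarrow> nat list \<Rightarrow> (nat set list \<Rightarrow> 'a::field) set
    \<Rightarrow> (nat set list \<Rightarrow> 'a) set \<Rightarrow> bool" where
  "G_iso_quot n \<mu> W1 W2 = (\<exists>\<phi>.
      (\<forall>x\<in>tspace n \<mu>. \<phi> x \<in> tspace n \<mu>) \<and>
      (\<forall>x\<in>tspace n \<mu>. \<forall>y\<in>tspace n \<mu>. \<phi> (\<lambda>I. x I + y I) = (\<lambda>I. \<phi> x I + \<phi> y I)) \<and>
      (\<forall>a. \<forall>x\<in>tspace n \<mu>. \<phi> (\<lambda>I. a * x I) = (\<lambda>I. a * \<phi> x I)) \<and>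
      (\<forall>x\<in>tspace n \<mu>. \<phi> x \<in> W2 \<longleftrightarrow> x \<in> W1) \<and>
      (\<forall>y\<in>tspace n \<mu>. \<exists>x\<in>tspace n \<mu>. (\<lambda>I. y I - \<phi> x I) \<in> W2) \<and>
      (\<forall>g. g \<in> carrier_mat n n \<and> det g \<noteq> 0 \<longrightarrow>
         (\<forall>x\<in>tspace n \<mu>. (\<lambda>I. \<phi> (gact n \<mu> g x) I - gact n \<mu> g (\<phi> x) I) \<in> W2)))"

end

theory Submission
  imports Defs "HOL-Combinatorics.Permutations" "HOL-Library.Product_Lexorder"
    "HOL-Library.Function_Algebras"
begin

text \<open>
  The two images coincide, so the identity induces the isomorphism. Both are spanned by relations
  on two adjacent factors, and these become statements about subsets: given a list of letters
  \<open>w\<close> of length \<open>a + k\<close>, a set \<open>P\<close> of \<open>k\<close> positions determines the tensor \<open>f P\<close> in which the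
  letters at \<open>P\<close> go to the second factor (in front of a fixed product \<open>z\<close>) and the others to the
  first. The image of \<open>\<gamma>\<^sub>k\<close> is spanned by the elements \<open>f P - (-1)^k \<Sum> f X\<close>, where \<open>X\<close> ranges over
  the \<open>k\<close>-sets disjoint from \<open>P\<close>, and the image of \<open>\<theta>\<^sub>1\<close> by the elements \<open>h D = \<Sum> f X\<close>, where
  \<open>D\<close> has \<open>k - 1\<close> elements and \<open>X\<close> ranges over the \<open>k\<close>-sets containing \<open>D\<close>.

  Inclusion-exclusion writes the sum over the sets disjoint from \<open>P\<close> as the alternating sum of
  \<open>h E\<close> over \<open>E \<subseteq> P\<close>. Since \<open>h P = f P\<close> and the \<open>h E\<close> with \<open>E\<close> smaller are combinations of \<open>\<theta>\<^sub>1\<close>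
  relations, the \<open>\<gamma>\<^sub>k\<close> relations follow. Conversely, summing the \<open>\<gamma>\<^sub>k\<close> relations over all
  \<open>P \<supseteq> D\<close> with \<open>card D = j\<close> gives, modulo the \<open>h E\<close> with \<open>E\<close> smaller, the element
  \<open>(1 - (-1)^(k+j) * ((a-j) choose (k-j))) h D\<close>; this factor is nonzero for \<open>j < k\<close> as soon as
  \<open>k = 1\<close> or \<open>k < a\<close>, and induction on \<open>j\<close> applies.
\<close>

section \<open>Sums over subsets of fixed size\<close>

locale vector_space_char_0 = vector_space scale
  for scale :: "'a::field_char_0 \<Rightarrow> 'v::ab_group_add \<Rightarrow> 'v" (infixr "*s" 75)
begin

definition upper_sum :: "'p set \<Rightarrow> nat \<Rightarrow> ('p set \<Rightarrow> 'v) \<Rightarrow> 'p set \<Rightarrow> 'v" where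
  "upper_sum \<Omega> k f D = (\<Sum>X\<in>{X. X \<subseteq> \<Omega> \<and> card X = k \<and> D \<subseteq> X}. f X)"

definition disjoint_sum :: "'p set \<Rightarrow> nat \<Rightarrow> ('p set \<Rightarrow> 'v) \<Rightarrow> 'p set \<Rightarrow> 'v" where
  "disjoint_sum \<Omega> k f D = (\<Sum>X\<in>{X. X \<subseteq> \<Omega> - D \<and> card X = k}. f X)"

text \<open>Expanding the product of \<open>- 1 + 1\<close> over \<open>D\<close> picks a subset
  \<open>E\<close>, the places where \<open>- 1\<close> is chosen; the product is zero once
  \<open>D\<close> has an element.\<close>

lemma sum_sign_Pow:
  assumes "finite D"
  shows "(\<Sum>E\<in>Pow D. (- 1) ^ card E) = (if D = {} then 1 else 0 :: 'a)"
proof -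
  have "(\<Sum>E\<in>Pow D. (- 1) ^ card E) = (\<Sum>E\<in>Pow D. (\<Prod>x\<in>E. - 1) * (\<Prod>x\<in>D - E. 1 :: 'a))"
    by simp
  also have "\<dots> = (\<Prod>x\<in>D. - 1 + 1)"
    using assms by (subst prod_add) (auto)
  also have "\<dots> = (if D = {} then 1 else 0)"
    using assms by auto
  finally show ?thesis .
qed

text \<open>After exchanging the sums, the coefficient of \<open>f X\<close> is the alternating sum
  over the subsets of \<open>D \<inter> X\<close>, which vanishes unless \<open>X\<close> avoids
  \<open>D\<close>.\<close>

lemma inclusion_exclusion:
  assumes fin: "finite \<Omega>" and D: "D \<subseteq> \<Omega>"
  shows "disjoint_sum \<Omega> k f D = (\<Sum>E\<in>Pow D. (- 1) ^ card E *s upper_sum \<Omega> k f E)"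
proof -
  let ?S = "{X. X \<subseteq> \<Omega> \<and> card X = k}"
  have finS: "finite ?S" using fin by (auto intro: finite_subset[of _ "Pow \<Omega>"])
  have finD: "finite D" using D fin by (rule finite_subset)
  have "(\<Sum>E\<in>Pow D. (- 1) ^ card E *s upper_sum \<Omega> k f E)
      = (\<Sum>E\<in>Pow D. \<Sum>X\<in>?S. (if E \<subseteq> X then (- 1) ^ card E else 0) *s f X)"
    unfolding upper_sum_def scale_sum_right
    by (intro sum.cong refl sum.mono_neutral_cong_left finS) auto
  also have "\<dots> = (\<Sum>X\<in>?S. (\<Sum>E\<in>Pow D. (if E \<subseteq> X then (- 1) ^ card E else 0)) *s f X)"
    by (subst sum.swap) (simp add: scale_sum_left)
  also have "\<dots> = (\<Sum>X\<in>?S. (if D \<inter> X = {} then 1 else 0) *s f X)"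
  proof (intro sum.cong refl arg_cong2[where f = scale])
    fix X
    have "(\<Sum>E\<in>Pow D. (if E \<subseteq> X then (- 1) ^ card E else 0)) = (\<Sum>E\<in>Pow (D \<inter> X). (- 1) ^ card E :: 'a)"
      using finD by (intro sum.mono_neutral_cong_right) auto
    then show "(\<Sum>E\<in>Pow D. (if E \<subseteq> X then (- 1) ^ card E else 0)) = (if D \<inter> X = {} then 1 else 0 :: 'a)"
      using finD by (simp only: sum_sign_Pow finite_Int simp_thms)
  qed
  also have "\<dots> = disjoint_sum \<Omega> k f D"
    unfolding disjoint_sum_def using finS
    by (intro sum.mono_neutral_cong_right) auto
  finally show ?thesis by simp
qed

text \<open>Modulo \<open>W\<close> only the term \<open>E = D\<close> of inclusion-exclusion
  survives. Both directions of the comparison rest on this.\<close>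

lemma disjoint_sum_minus_upper_sum:
  assumes W: "subspace W" and fin: "finite \<Omega>" and D: "D \<subseteq> \<Omega>"
    and low: "\<And>E. E \<subset> D \<Longrightarrow> upper_sum \<Omega> k f E \<in> W"
  shows "disjoint_sum \<Omega> k f D - (- 1) ^ card D *s upper_sum \<Omega> k f D \<in> W"
proof -
  have finD: "finite D" using D fin by (rule finite_subset)
  have "disjoint_sum \<Omega> k f D - (- 1) ^ card D *s upper_sum \<Omega> k f D
      = (\<Sum>E\<in>Pow D - {D}. (- 1) ^ card E *s upper_sum \<Omega> k f E)"
    using finD by (simp add: inclusion_exclusion[OF fin D] sum_diff1)
  also have "\<dots> \<in> W"
    using low by (intro subspace_sum[OF W] subspace_scale[OF W]) auto
  finally show ?thesis .
qed

text \<open>Double counting: for a fixed \<open>X\<close>, the sets \<open>P\<close> that avoid it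
  consist of \<open>D\<close> and any \<open>k - card D\<close> of the \<open>a - card D\<close>
  positions outside \<open>D \<union> X\<close>.\<close>

lemma sum_upper_disjoint:
  assumes fin: "finite \<Omega>" and card: "card \<Omega> = a + k" and D: "D \<subseteq> \<Omega>" "card D \<le> k"
  shows "(\<Sum>P\<in>{P. P \<subseteq> \<Omega> \<and> card P = k \<and> D \<subseteq> P}. disjoint_sum \<Omega> k f P)
    = of_nat ((a - card D) choose (k - card D)) *s disjoint_sum \<Omega> k f D"
proof -
  let ?U = "{P. P \<subseteq> \<Omega> \<and> card P = k \<and> D \<subseteq> P}" and ?V = "{X. X \<subseteq> \<Omega> - D \<and> card X = k}"
  have finD: "finite D" using D(1) fin by (rule finite_subset)
  have finU: "finite ?U" and finV: "finite ?V"
    using fin by (auto intro: finite_subset[of _ "Pow \<Omega>"])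
  have "(\<Sum>P\<in>?U. disjoint_sum \<Omega> k f P) = (\<Sum>P\<in>?U. \<Sum>X\<in>?V. if P \<inter> X = {} then f X else 0)"
    unfolding disjoint_sum_def
    by (intro sum.cong refl sum.mono_neutral_cong_left finV) auto
  also have "\<dots> = (\<Sum>X\<in>?V. \<Sum>P\<in>?U. if P \<inter> X = {} then f X else 0)"
    by (rule sum.swap)
  also have "\<dots> = (\<Sum>X\<in>?V. of_nat ((a - card D) choose (k - card D)) *s f X)"
  proof (intro sum.cong refl)
    fix X assume X: "X \<in> ?V"
    have finX: "finite X" using X fin finite_subset by blast
    let ?Q = "{Q. Q \<subseteq> \<Omega> - D - X \<and> card Q = k - card D}"
    have "bij_betw (\<lambda>Q. Q \<union> D) ?Q {P \<in> ?U. P \<inter> X = {}}"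
    proof (rule bij_betwI[where g = "\<lambda>P. P - D"])
      show "(\<lambda>Q. Q \<union> D) \<in> ?Q \<rightarrow> {P \<in> ?U. P \<inter> X = {}}"
      proof
        fix Q assume Q: "Q \<in> ?Q"
        have "finite Q" using Q fin finite_subset by blast
        then have "card (Q \<union> D) = card Q + card D"
          using Q finD by (intro card_Un_disjoint) auto
        then show "Q \<union> D \<in> {P \<in> ?U. P \<inter> X = {}}"
          using Q D X by auto
      qed
      show "(\<lambda>P. P - D) \<in> {P \<in> ?U. P \<inter> X = {}} \<rightarrow> ?Q"
        using finD by (auto simp: card_Diff_subset)
    qed auto
    then have "card {P \<in> ?U. P \<inter> X = {}} = card ?Q"
      by (simp add: bij_betw_same_card)
    also have "\<dots> = (card (\<Omega> - D - X)) choose (k - card D)"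
      using fin by (intro n_subsets) auto
    also have "card (\<Omega> - D - X) = a - card D"
      using X D finX finD card by (simp add: card_Diff_subset)
    finally have c: "card {P \<in> ?U. P \<inter> X = {}} = (a - card D) choose (k - card D)" .
    have "(\<Sum>P\<in>?U. if P \<inter> X = {} then f X else 0) = (\<Sum>P\<in>{P \<in> ?U. P \<inter> X = {}}. f X)"
      using finU by (intro sum.mono_neutral_cong_right) auto
    then show "(\<Sum>P\<in>?U. if P \<inter> X = {} then f X else 0) = of_nat ((a - card D) choose (k - card D)) *s f X"
      by (simp only: sum_constant_scale c)
  qed
  finally show ?thesis
    by (simp add: disjoint_sum_def scale_sum_right)
qed

text \<open>For \<open>k = 1\<close> the sign is negative and the value is \<open>1 + a\<close>. For
  \<open>j < k < a\<close> the binomial coefficient is at least 2. For \<open>1 < k = a\<close> the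
  claim fails: at \<open>j = k - 2\<close> sign and coefficient are both 1.\<close>

lemma sign_binomial_neq_1:
  assumes "j < k" "k = 1 \<or> k < a"
  shows "(1 :: 'a) - (- 1) ^ (k + j) * of_nat ((a - j) choose (k - j)) \<noteq> 0"
proof (cases "k = 1")
  case True
  with assms have "1 - (- 1) ^ (k + j) * of_nat ((a - j) choose (k - j)) = (of_nat (1 + a) :: 'a)"
    by simp
  then show ?thesis by (simp del: of_nat_add of_nat_Suc)
next
  case False
  obtain m s where ms: "a - j = Suc m" "k - j = Suc s" "Suc s \<le> m"
    using assms False by (cases "a - j"; cases "k - j") auto
  define C where "C = Suc m choose Suc s"
  have "0 < m choose s" "0 < m choose Suc s" using ms(3) by auto
  then have "2 \<le> C" unfolding C_def binomial_Suc_Suc by linarith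
  show ?thesis
  proof
    assume "1 - (- 1) ^ (k + j) * of_nat ((a - j) choose (k - j)) = (0 :: 'a)"
    then have "(- 1) ^ (k + j) * of_nat C = (1 :: 'a)"
      unfolding ms C_def by simp
    \<comment> \<open>Characteristic zero moves the equation to the integers, where absolute values
      can be compared.\<close>
    then have "(of_int ((- 1) ^ (k + j) * int C) :: 'a) = of_int 1" by simp
    then have "(- 1) ^ (k + j) * int C = 1" by (simp only: of_int_eq_iff)
    then have "\<bar>(- 1) ^ (k + j) * int C\<bar> = 1" by simp
    then show False using \<open>2 \<le> C\<close> by (simp add: abs_mult)
  qed
qed

text \<open>The direction from \<open>\<gamma>\<close> to \<open>\<theta>\<close>, by strong
  induction on \<open>card D\<close>. The hypothesis on \<open>k\<close> makes the final factor
  invertible.\<close>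

lemma upper_sum_mem:
  assumes W: "subspace W" and fin: "finite \<Omega>" and card: "card \<Omega> = a + k"
    and k: "k = 1 \<or> k < a"
    and rel: "\<And>P. P \<subseteq> \<Omega> \<Longrightarrow> card P = k \<Longrightarrow> f P - (- 1) ^ k *s disjoint_sum \<Omega> k f P \<in> W"
    and D: "D \<subseteq> \<Omega>" "card D < k"
  shows "upper_sum \<Omega> k f D \<in> W"
  using D
proof (induction "card D" arbitrary: D rule: less_induct)
  case less
  have finD: "finite D" using less.prems(1) fin by (rule finite_subset)
  let ?j = "card D" let ?C = "of_nat ((a - card D) choose (k - card D)) :: 'a"
  let ?h = "upper_sum \<Omega> k f D" and ?d = "disjoint_sum \<Omega> k f D"
  have "upper_sum \<Omega> k f E \<in> W" if "E \<subset> D" for E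
    using less.hyps[of E] less.prems that psubset_card_mono[OF finD that] by auto
  then have 1: "?d - (- 1) ^ ?j *s ?h \<in> W"
    by (intro disjoint_sum_minus_upper_sum W fin less.prems(1))
  have "(\<Sum>P\<in>{P. P \<subseteq> \<Omega> \<and> card P = k \<and> D \<subseteq> P}. f P - (- 1) ^ k *s disjoint_sum \<Omega> k f P) \<in> W"
    by (intro subspace_sum[OF W] rel) auto
  moreover have "(\<Sum>P\<in>{P. P \<subseteq> \<Omega> \<and> card P = k \<and> D \<subseteq> P}. f P - (- 1) ^ k *s disjoint_sum \<Omega> k f P)
      = ?h - (- 1) ^ k *s (?C *s ?d)"
    using sum_upper_disjoint[OF fin card, of D f] less.prems
    by (simp add: sum_subtractf upper_sum_def scale_sum_right[symmetric])
  ultimately have 2: "?h - (- 1) ^ k *s (?C *s ?d) \<in> W" by simp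
  \<comment> \<open>The multiple of the first congruence is chosen so that \<open>?d\<close> cancels
    against the second.\<close>
  have "(1 - (- 1) ^ (k + ?j) * ?C) *s ?h
      = (?h - (- 1) ^ k *s (?C *s ?d)) + ((- 1) ^ k * ?C) *s (?d - (- 1) ^ ?j *s ?h)"
    by (simp add: algebra_simps power_add)
  also have "\<dots> \<in> W"
    by (intro subspace_add[OF W] subspace_scale[OF W] 1 2)
  finally have 3: "(1 - (- 1) ^ (k + ?j) * ?C) *s ?h \<in> W" .
  from subspace_scale[OF W this, of "inverse (1 - (- 1) ^ (k + ?j) * ?C)"]
  show ?case using sign_binomial_neq_1[OF less.prems(2) k] by simp
qed

text \<open>The direction from \<open>\<theta>\<close> to \<open>\<gamma>\<close>. Only the sums for
  \<open>k - 1\<close> points are given; those for fewer points follow by averaging, and then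
  inclusion-exclusion at \<open>P\<close> applies.\<close>

lemma exchange_mem:
  assumes W: "subspace W" and fin: "finite \<Omega>" 
    and rel: "\<And>D. D \<subseteq> \<Omega> \<Longrightarrow> Suc (card D) = k \<Longrightarrow> upper_sum \<Omega> k f D \<in> W"
    and P: "P \<subseteq> \<Omega>" "card P = k"
  shows "f P - (- 1) ^ k *s disjoint_sum \<Omega> k f P \<in> W"
proof -
  have finP: "finite P" using P(1) fin by (rule finite_subset)
  have low: "upper_sum \<Omega> k f D \<in> W" if "D \<subseteq> \<Omega>" "card D < k" for D
    using that
  proof (induction "k - card D" arbitrary: D rule: less_induct)
    case less
    have finD: "finite D" using less.prems(1) fin by (rule finite_subset)
    show ?case
    proof (cases "Suc (card D) = k")
      case False
      \<comment> \<open>Adding one point in all possible ways counts each \<open>X\<close>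
        containing \<open>D\<close> once per element of \<open>X - D\<close>, hence
        \<open>k - card D\<close> times; characteristic zero permits dividing by this
        number.\<close>
      have "(\<Sum>x\<in>\<Omega> - D. upper_sum \<Omega> k f (insert x D)) \<in> W"
      proof (rule subspace_sum[OF W])
        fix x assume x: "x \<in> \<Omega> - D"
        then have "card (insert x D) = Suc (card D)" using finD by simp
        then show "upper_sum \<Omega> k f (insert x D) \<in> W"
          using less False x by auto
      qed
      also have "(\<Sum>x\<in>\<Omega> - D. upper_sum \<Omega> k f (insert x D))
        = (\<Sum>x\<in>\<Omega> - D. \<Sum>X\<in>{X. X \<subseteq> \<Omega> \<and> card X = k \<and> D \<subseteq> X}. if x \<in> X then f X else 0)"
        unfolding upper_sum_def using fin
        by (intro sum.cong refl sum.mono_neutral_cong_left) (auto intro: finite_subset[of _ "Pow \<Omega>"])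
      also have "\<dots> = (\<Sum>X\<in>{X. X \<subseteq> \<Omega> \<and> card X = k \<and> D \<subseteq> X}. \<Sum>x\<in>\<Omega> - D. if x \<in> X then f X else 0)"
        by (rule sum.swap)
      also have "\<dots> = (\<Sum>X\<in>{X. X \<subseteq> \<Omega> \<and> card X = k \<and> D \<subseteq> X}. of_nat (k - card D) *s f X)"
      proof (intro sum.cong refl)
        fix X assume X: "X \<in> {X. X \<subseteq> \<Omega> \<and> card X = k \<and> D \<subseteq> X}"
        have "(\<Sum>x\<in>\<Omega> - D. if x \<in> X then f X else 0) = (\<Sum>x\<in>X - D. f X)"
          using X fin by (intro sum.mono_neutral_cong_right) auto
        then show "(\<Sum>x\<in>\<Omega> - D. if x \<in> X then f X else 0) = of_nat (k - card D) *s f X"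
          using X finD by (simp add: sum_constant_scale card_Diff_subset)
      qed
      also have "\<dots> = of_nat (k - card D) *s upper_sum \<Omega> k f D"
        by (simp add: upper_sum_def scale_sum_right)
      finally have "of_nat (k - card D) *s upper_sum \<Omega> k f D \<in> W" .
      from subspace_scale[OF W this, of "inverse (of_nat (k - card D))"]
      show ?thesis using less.prems by simp
    qed (use rel less.prems in auto)
  qed
  have "{X. X \<subseteq> \<Omega> \<and> card X = k \<and> P \<subseteq> X} = {P}"
    using P fin card_subset_eq[of _ P] by (blast dest: finite_subset)
  then have "upper_sum \<Omega> k f P = f P" by (simp add: upper_sum_def)
  moreover have "disjoint_sum \<Omega> k f P - (- 1) ^ card P *s upper_sum \<Omega> k f P \<in> W"
    using low P psubset_card_mono[OF finP] by (intro disjoint_sum_minus_upper_sum W fin) auto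
  \<comment> \<open>Since \<open>(- 1) ^ k\<close> squares to 1, this scaling gives
    \<open>f P\<close> coefficient 1.\<close>
  ultimately have "- ((- 1) ^ k *s (disjoint_sum \<Omega> k f P - (- 1) ^ k *s f P)) \<in> W"
    using P by (intro subspace_neg[OF W] subspace_scale[OF W]) simp
  then show ?thesis by (simp add: algebra_simps flip: power_mult_distrib)
qed

end

section \<open>Alternating families of two-column tensors\<close>

fun inversions :: "'a::linorder list \<Rightarrow> nat" where
  "inversions [] = 0"
| "inversions (x # xs) = length (filter (\<lambda>y. y < x) xs) + inversions xs"

definition crossings :: "'a::linorder list \<Rightarrow> 'a list \<Rightarrow> nat" where
  "crossings xs ys = (\<Sum>x\<leftarrow>xs. length (filter (\<lambda>y. y < x) ys))"

lemma inversions_append: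
  "inversions (xs @ ys) = inversions xs + inversions ys + crossings xs ys"
  by (induction xs) (auto simp: crossings_def)

lemma crossings_append_left: "crossings (xs @ xs') ys = crossings xs ys + crossings xs' ys"
  by (simp add: crossings_def)

lemma crossings_append_right: "crossings xs (ys @ ys') = crossings xs ys + crossings xs ys'"
  by (induction xs) (auto simp: crossings_def)

lemma inversions_sorted: "sorted xs \<Longrightarrow> inversions xs = 0"
  by (induction xs) (auto simp: filter_empty_conv)

lemma crossings_eq_0: "(\<And>x y. x \<in> set xs \<Longrightarrow> y \<in> set ys \<Longrightarrow> x \<le> y) \<Longrightarrow> crossings xs ys = 0"
  by (induction xs) (auto simp: crossings_def filter_empty_conv not_less)

lemma crossings_eq_card:
  assumes "distinct xs" "distinct ys"
  shows "crossings xs ys = card {(x, y). x \<in> set xs \<and> y \<in> set ys \<and> y < x}"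
proof -
  have "{(x, y). x \<in> set xs \<and> y \<in> set ys \<and> y < x} = (SIGMA x:set xs. {y \<in> set ys. y < x})"
    by auto
  then have "card {(x, y). x \<in> set xs \<and> y \<in> set ys \<and> y < x} = (\<Sum>x\<in>set xs. card {y \<in> set ys. y < x})"
    by simp
  also have "\<dots> = (\<Sum>x\<in>set xs. length (filter (\<lambda>y. y < x) ys))"
    using assms by (intro sum.cong refl) (simp add: distinct_card[symmetric] distinct_filter)
  also have "\<dots> = crossings xs ys"
    using assms by (simp add: crossings_def sum_list_distinct_conv_sum_set)
  finally show ?thesis by simp
qed

text \<open>The Boolean tag \<open>True\<close> sends a letter to the second tensor factor.\<close>

definition mark :: "nat list \<Rightarrow> nat set \<Rightarrow> (bool \<times> nat) list" where
  "mark w P = map (\<lambda>i. (i \<in> P, w ! i)) [0..<length w]"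

lemma length_mark [simp]: "length (mark w P) = length w"
  by (simp add: mark_def)

lemma nth_mark: "i < length w \<Longrightarrow> mark w P ! i = (i \<in> P, w ! i)"
  by (simp add: mark_def)

lemma mark_append:
  "mark (u @ v) P = mark u P @ mark v {j. length u + j \<in> P}"
  by (rule nth_equalityI) (auto simp: nth_mark nth_append)

text \<open>Entry \<open>i\<close> of the permuted word is the letter at \<open>\<pi> i\<close>, so
  a tag at \<open>i\<close> corresponds to a tag at \<open>\<pi> i\<close> in the original
  word.\<close>

lemma mark_permute:
  assumes "\<pi> permutes {..<length w}"
  shows "mark (permute_list \<pi> w) P = permute_list \<pi> (mark w (\<pi> ` P))"
proof (rule nth_equalityI)
  fix i assume i: "i < length (mark (permute_list \<pi> w) P)"
  then have "\<pi> i < length w" using permutes_in_image[OF assms, of i] by simp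
  then show "mark (permute_list \<pi> w) P ! i = permute_list \<pi> (mark w (\<pi> ` P)) ! i"
    using i assms permutes_inj[OF assms] by (auto simp: nth_mark permute_list_nth inj_image_mem_iff)
qed simp

lemma mark_all_False: "(\<And>i. i < length w \<Longrightarrow> i \<notin> P) \<Longrightarrow> mark w P = map (Pair False) w"
  by (rule nth_equalityI) (auto simp: nth_mark)

lemma mark_all_True: "(\<And>i. i < length w \<Longrightarrow> i \<in> P) \<Longrightarrow> mark w P = map (Pair True) w"
  by (rule nth_equalityI) (auto simp: nth_mark)

lemma mark_inject:
  assumes "mark v P = mark w Q" "P \<subseteq> {..<length v}" "Q \<subseteq> {..<length w}"
  shows "v = w" "P = Q"
proof -
  have len: "length v = length w" using arg_cong[OF assms(1), of length] by simp
  have *: "(i \<in> P, v ! i) = (i \<in> Q, w ! i)" if "i < length v" for i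
    using that len arg_cong[OF assms(1), of "\<lambda>x. x ! i"] by (simp add: nth_mark)
  show "v = w" using len * by (auto intro: nth_equalityI)
  show "P = Q"
  proof (rule Set.set_eqI)
    fix i show "i \<in> P \<longleftrightarrow> i \<in> Q"
      using *[of i] len assms(2,3) by (cases "i < length v") auto
  qed
qed

text \<open>A letter may occur twice in \<open>w\<close>, but then with different tags. So the
  tagged word and its sorted form are distinct lists with the same entries, and some permutation
  relates them.\<close>

lemma exists_sorting_permutation:
  assumes P: "P \<subseteq> {..<length w}" and dist: "distinct (mark w P)"
  defines "A \<equiv> {w ! i | i. i < length w \<and> i \<notin> P}" and "B \<equiv> {w ! i | i. i \<in> P}"
  obtains \<pi> where "\<pi> permutes {..<length w}"
    "permute_list \<pi> w = sorted_list_of_set A @ sorted_list_of_set B"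
    "\<pi> ` {card A..<length w} = P" "card B = card P" "card A = length w - card P"
proof -
  let ?u = "sorted_list_of_set A" and ?v = "sorted_list_of_set B"
  let ?M = "mark w P" and ?L = "mark (?u @ ?v) {card A..<length w}"
  have inj: "i = j" if "i < length w" "j < length w" "w ! i = w ! j" "i \<in> P \<longleftrightarrow> j \<in> P" for i j
    using dist that by (auto simp: distinct_conv_nth nth_mark)
  have finP: "finite P" using P finite_subset by blast
  have B: "B = (!) w ` P" and A: "A = (!) w ` ({..<length w} - P)"
    by (auto simp: A_def B_def)
  have cB: "card B = card P" unfolding B
    using P by (intro card_image inj_onI) (use inj in blast)
  have "card A = card ({..<length w} - P)" unfolding A
    using P by (intro card_image inj_onI) (use inj in blast)
  then have cA: "card A = length w - card P"
    using P finP by (simp add: card_Diff_subset)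
  have "card P \<le> length w" using P card_mono[of "{..<length w}" P] by simp
  then have len: "length w = card A + card B" using cA cB by simp
  have fin: "finite A" "finite B" using finP by (simp_all add: A B)
  have L: "?L = map (Pair False) ?u @ map (Pair True) ?v"
    unfolding mark_append by (intro arg_cong2[where f = append] mark_all_False mark_all_True)
      (auto simp: len)
  have "set ?M = set ?L"
  proof -
    have "set ?M = Pair False ` A \<union> Pair True ` B"
    proof (intro equalityI subsetI)
      fix z assume "z \<in> set ?M"
      then obtain i where "i < length w" "z = (i \<in> P, w ! i)" by (auto simp: mark_def)
      then show "z \<in> Pair False ` A \<union> Pair True ` B"
        unfolding A B by (cases "i \<in> P") auto
    next
      fix z assume "z \<in> Pair False ` A \<union> Pair True ` B"
      then obtain i where "i < length w" "z = (i \<in> P, w ! i)"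
        unfolding A B using P by auto
      then show "z \<in> set ?M" by (auto simp: mark_def)
    qed
    then show ?thesis unfolding L using fin by simp
  qed
  moreover have "distinct ?L"
    unfolding L by (auto simp: distinct_map inj_on_def)
  ultimately have "mset ?L = mset ?M"
    using dist by (simp add: set_eq_iff_mset_eq_distinct)
  then obtain \<pi> where \<pi>: "\<pi> permutes {..<length ?M}" "permute_list \<pi> ?M = ?L"
    by (rule mset_eq_permutation)
  have \<pi>': "\<pi> permutes {..<length w}" using \<pi> by simp
  have im: "\<pi> ` (\<pi> -` P) = P"
    using permutes_surj[OF \<pi>'] by (rule surj_image_vimage_eq)
  have sub: "\<pi> -` P \<subseteq> {..<length w}"
    using P permutes_in_image[OF \<pi>'] by fastforce
  \<comment> \<open>Both sides are tagged words, so equality yields the underlying word and the set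
    of tagged positions separately.\<close>
  have "mark (permute_list \<pi> w) (\<pi> -` P) = ?L"
    using \<pi>(2) mark_permute[OF \<pi>', of "\<pi> -` P"] im by simp
  moreover have "\<pi> -` P \<subseteq> {..<length (permute_list \<pi> w)}" using sub by simp
  moreover have "{card A..<length w} \<subseteq> {..<length (?u @ ?v)}" using len by auto
  ultimately have "permute_list \<pi> w = ?u @ ?v" "\<pi> -` P = {card A..<length w}"
    by (rule mark_inject)+
  with that[OF \<pi>'] im cA cB show thesis by simp
qed

section \<open>Alternating functions of tagged words\<close>

locale two_columns = vector_space_char_0 scale
  for scale :: "'a::field_char_0 \<Rightarrow> 'v::ab_group_add \<Rightarrow> 'v" (infixr "*s" 75) +
  fixes U :: "nat set \<Rightarrow> nat set \<Rightarrow> 'v"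
begin

text \<open>Up to the identification of the exterior algebra of \<open>V \<oplus> V\<close> with \<open>\<Lambda> \<otimes> \<Lambda>\<close>, this is the product
  of the tagged letters in the order of the list.\<close>

definition alt :: "(bool \<times> nat) list \<Rightarrow> 'v" where
  "alt L = (if distinct L
     then (- 1) ^ inversions L *s U {i. (False, i) \<in> set L} {i. (True, i) \<in> set L} else 0)"

text \<open>Only the relative order of \<open>x\<close> and \<open>y\<close> changes, so the number
  of inversions changes by one. If \<open>x = y\<close>, both sides are zero.\<close>

lemma alt_swap: "alt (P @ x # y # Q) = - alt (P @ y # x # Q)"
proof (cases "x = y")
  case True
  then show ?thesis by (simp add: alt_def)
next
  case False
  have "crossings P (x # y # Q) = crossings P (y # x # Q)"
    by (induction P) (auto simp: crossings_def)
  with False have "inversions (P @ x # y # Q) = Suc (inversions (P @ y # x # Q))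
      \<or> inversions (P @ y # x # Q) = Suc (inversions (P @ x # y # Q))"
    by (cases x y rule: linorder_cases) (auto simp: inversions_append not_less less_imp_le)
  then have "(- 1) ^ inversions (P @ x # y # Q) = - ((- 1) ^ inversions (P @ y # x # Q) :: 'a)"
    by auto
  moreover have "set (P @ x # y # Q) = set (P @ y # x # Q)"
    "distinct (P @ x # y # Q) = distinct (P @ y # x # Q)" by auto
  ultimately show ?thesis
    unfolding alt_def by (simp only: scale_minus_left minus_zero if_distrib[of uminus] cong: if_cong)
qed

lemma alt_move: "alt (P @ x # Q @ R) = (- 1) ^ length Q *s alt (P @ Q @ x # R)"
proof (induction Q arbitrary: P)
  case (Cons q Q)
  show ?case using alt_swap[of P x q "Q @ R"] Cons.IH[of "P @ [q]"] by simp
qed simp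

lemma alt_block_swap:
  "alt (P @ Q @ Q' @ R) = (- 1) ^ (length Q * length Q') *s alt (P @ Q' @ Q @ R)"
proof (induction Q' arbitrary: P)
  case (Cons q Q')
  have "alt (P @ q # Q @ Q' @ R) = (- 1) ^ length Q *s alt (P @ Q @ q # Q' @ R)"
    by (rule alt_move)
  from arg_cong[OF this, of "scale ((- 1) ^ length Q)"] Cons.IH[of "P @ [q]"]
  show ?case by (simp add: power_add flip: power_mult_distrib)
qed simp

text \<open>Moving \<open>x\<close> right past \<open>Q\<close> and \<open>y\<close> left past
  \<open>Q\<close> costs the same sign twice; the adjacent swap between them leaves the
  minus.\<close>

lemma alt_exchange: "alt (P @ x # Q @ y # R) = - alt (P @ y # Q @ x # R)"
  using alt_move[of P x Q "y # R"] alt_swap[of "P @ Q" x y R] alt_move[of P y Q "x # R"]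
  by simp

lemma alt_transpose:
  assumes ij: "i < length L" "j < length L" "i < j"
  shows "alt (permute_list (transpose i j) L @ R) = - alt (L @ R)"
proof -
  let ?P = "take i L" and ?Q = "drop (Suc i) (take j L)" and ?R = "drop (Suc j) L"
  have L: "L = ?P @ L ! i # ?Q @ L ! j # ?R"
  proof -
    have "L = take j L @ L ! j # ?R" using ij by (simp add: id_take_nth_drop)
    moreover have "take j L = ?P @ L ! i # ?Q"
      using ij id_take_nth_drop[of i "take j L"] by (simp add: min_def)
    ultimately show ?thesis by (metis append.assoc append_Cons)
  qed
  have "permute_list (transpose i j) L = ?P @ L ! j # ?Q @ L ! i # ?R"
    using ij by (intro nth_equalityI)
      (auto simp: permute_list_def nth_append nth_Cons' transpose_def min_def)
  then show ?thesis
    using alt_exchange[of ?P "L ! j" ?Q "L ! i" "?R @ R"] L by (metis append.assoc append_Cons)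
qed

text \<open>Induction on a product of transpositions. The suffix \<open>R\<close> stays fixed
  because it will hold letters outside the exchange.\<close>

lemma alt_permute:
  assumes "\<pi> permutes {..<length L}"
  shows "alt (permute_list \<pi> L @ R) = of_int (sign \<pi>) *s alt (L @ R)"
proof -
  \<comment> \<open>The list is generalized since the induction hypothesis is applied to an already
    transposed list.\<close>
  have "\<forall>L'. length L' = length L \<longrightarrow> alt (permute_list \<pi> L' @ R) = of_int (sign \<pi>) *s alt (L' @ R)"
    using assms finite_lessThan[of "length L"]
  proof (induction rule: permutes_induct)
    case (swap a b p)
    have tr: "transpose a b permutes {..<length L}" using swap by (intro permutes_swap_id) auto
    have s: "sign (transpose a b \<circ> p) = - sign p"
      using swap tr by (subst sign_compose) (auto simp: sign_swap_id intro: permutes_imp_permutation[of "{..<length L}"])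
    show ?case
    proof (intro allI impI)
      fix L' :: "(bool \<times> nat) list" assume len: "length L' = length L"
      have "alt (permute_list (transpose a b) L' @ R) = - alt (L' @ R)"
        using swap len alt_transpose[of a L' b R] alt_transpose[of b L' a R]
        by (cases a b rule: linorder_cases) (auto simp: transpose_commute)
      then show "alt (permute_list (transpose a b \<circ> p) L' @ R) = of_int (sign (transpose a b \<circ> p)) *s alt (L' @ R)"
        using swap len by (simp add: permute_list_compose s)
    qed
  qed (auto simp: sign_id)
  then show ?thesis by blast
qed

end

lemma sorted_list_of_set_eqI:
  assumes "sorted xs" "distinct xs" "set xs = S"
  shows "sorted_list_of_set S = xs"
  using assms by (metis sorted_list_of_set_unique finite_set distinct_card sorted_list_of_set.idem_if_sorted_distinct)

lemma sgn2_eq_crossings: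
  assumes "finite S" "finite T"
  shows "sgn2 S T = (- 1) ^ crossings (sorted_list_of_set S) (sorted_list_of_set T)"
  using assms by (simp add: sgn2_def crossings_eq_card)

section \<open>Subset sums under permutations of the positions\<close>

context vector_space_char_0
begin

lemma disjoint_sum_permute:
  assumes "\<pi> permutes \<Omega>"
  shows "disjoint_sum \<Omega> k (\<lambda>X. f (\<pi> ` X)) P = disjoint_sum \<Omega> k f (\<pi> ` P)"
  unfolding disjoint_sum_def
proof (rule sum.reindex_bij_betw, rule bij_betwI[where g = "vimage \<pi>"])
  note inj = permutes_inj[OF assms] and surj = permutes_surj[OF assms]
  show "(`) \<pi> \<in> {X. X \<subseteq> \<Omega> - P \<and> card X = k} \<rightarrow> {X. X \<subseteq> \<Omega> - \<pi> ` P \<and> card X = k}"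
    using permutes_image[OF assms] inj
    by (auto simp: card_image inj_on_subset permutes_in_image[OF assms] dest: injD)
  show "vimage \<pi> \<in> {X. X \<subseteq> \<Omega> - \<pi> ` P \<and> card X = k} \<rightarrow> {X. X \<subseteq> \<Omega> - P \<and> card X = k}"
    using inj surj permutes_in_image[OF assms] by (fastforce simp: card_vimage_inj)
qed (use permutes_inj[OF assms] permutes_surj[OF assms] in
     \<open>auto simp: inj_vimage_image_eq surj_image_vimage_eq\<close>)

lemma upper_sum_permute:
  assumes "\<pi> permutes \<Omega>"
  shows "upper_sum \<Omega> k (\<lambda>X. f (\<pi> ` X)) D = upper_sum \<Omega> k f (\<pi> ` D)"
  unfolding upper_sum_def
proof (rule sum.reindex_bij_betw, rule bij_betwI[where g = "vimage \<pi>"])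
  note inj = permutes_inj[OF assms] and surj = permutes_surj[OF assms]
  show "(`) \<pi> \<in> {X. X \<subseteq> \<Omega> \<and> card X = k \<and> D \<subseteq> X} \<rightarrow> {X. X \<subseteq> \<Omega> \<and> card X = k \<and> \<pi> ` D \<subseteq> X}"
    using permutes_image[OF assms] inj
    by (auto simp: card_image inj_on_subset permutes_in_image[OF assms])
  show "vimage \<pi> \<in> {X. X \<subseteq> \<Omega> \<and> card X = k \<and> \<pi> ` D \<subseteq> X} \<rightarrow> {X. X \<subseteq> \<Omega> \<and> card X = k \<and> D \<subseteq> X}"
    using inj surj permutes_in_image[OF assms] by (fastforce simp: card_vimage_inj)
qed (use permutes_inj[OF assms] permutes_surj[OF assms] in
     \<open>auto simp: inj_vimage_image_eq surj_image_vimage_eq\<close>)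

lemma upper_sum_insert:
  assumes "finite \<Omega>" "D \<subseteq> \<Omega>" "k = Suc (card D)"
  shows "upper_sum \<Omega> k f D = (\<Sum>i\<in>\<Omega> - D. f (insert i D))"
  unfolding upper_sum_def
proof (rule sum.reindex_bij_betw[symmetric])
  have finD: "finite D" using assms finite_subset by blast
  have inj: "inj_on (\<lambda>i. insert i D) (\<Omega> - D)" by (auto simp: inj_on_def)
  have "(\<lambda>i. insert i D) ` (\<Omega> - D) = {X. X \<subseteq> \<Omega> \<and> card X = k \<and> D \<subseteq> X}"
  proof (intro equalityI subsetI)
    fix X assume X: "X \<in> {X. X \<subseteq> \<Omega> \<and> card X = k \<and> D \<subseteq> X}"
    then have "card (X - D) = 1" using finD assms by (simp add: card_Diff_subset)
    then obtain i where "X - D = {i}" by (auto simp: card_1_singleton_iff)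
    then show "X \<in> (\<lambda>i. insert i D) ` (\<Omega> - D)" using X by (intro image_eqI[of _ _ i]) auto
  qed (use assms finD in auto)
  with inj show "bij_betw (\<lambda>i. insert i D) (\<Omega> - D) {X. X \<subseteq> \<Omega> \<and> card X = k \<and> D \<subseteq> X}"
    by (simp add: bij_betw_def)
qed

text \<open>Sorting the tagged letters reduces a family of relations that is alternating in the
  positions to its members with increasing letters; a repeated tagged letter makes a member
  vanish, because exchanging the two copies changes its sign.\<close>

lemma equivariant_mem:
  fixes rel :: "nat list \<Rightarrow> nat set \<Rightarrow> 'v"
  assumes W: "subspace W"
    and rel: "\<And>\<pi> w P. \<pi> permutes {..<length w} \<Longrightarrow>
      rel (permute_list \<pi> w) P = of_int (sign \<pi>) *s rel w (\<pi> ` P)"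
    and base: "\<And>A B. A \<subseteq> {..<n} \<Longrightarrow> B \<subseteq> {..<n} \<Longrightarrow> card A = p \<Longrightarrow> card B = q \<Longrightarrow>
      rel (sorted_list_of_set A @ sorted_list_of_set B) {p..<p + q} \<in> W"
    and w: "set w \<subseteq> {..<n}" "length w = p + q" and P: "P \<subseteq> {..<p + q}" "card P = q"
  shows "rel w P \<in> W"
proof (cases "distinct (mark w P)")
  case True
  let ?A = "{w ! i | i. i < length w \<and> i \<notin> P}" and ?B = "{w ! i | i. i \<in> P}"
  from P w have "P \<subseteq> {..<length w}" by simp
  from exists_sorting_permutation[OF this True] obtain \<pi> where \<pi>: "\<pi> permutes {..<length w}"
    "permute_list \<pi> w = sorted_list_of_set ?A @ sorted_list_of_set ?B"
    "\<pi> ` {card ?A..<length w} = P" "card ?B = card P" "card ?A = length w - card P"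
    by blast
  have c: "card ?A = p" "card ?B = q" using \<pi> w P by simp_all
  have "w ! i < n" if "i < length w" for i using w nth_mem[OF that] by auto
  then have "?A \<subseteq> {..<n}" "?B \<subseteq> {..<n}" using w P by auto
  then have "rel (permute_list \<pi> w) {p..<p + q} \<in> W"
    unfolding \<pi>(2) using c by (intro base) auto
  also have "rel (permute_list \<pi> w) {p..<p + q} = of_int (sign \<pi>) *s rel w P"
    using rel[OF \<pi>(1), of "{p..<p + q}"] \<pi>(3) c w by simp
  \<comment> \<open>A second factor of the sign cancels the first.\<close>
  finally have "of_int (sign \<pi>) *s (of_int (sign \<pi>) *s rel w P) \<in> W"
    by (rule subspace_scale[OF W])
  then show ?thesis by (simp flip: of_int_mult)
next
  case False
  then obtain i j where ij: "i < length w" "j < length w" "i \<noteq> j" "w ! i = w ! j" "i \<in> P \<longleftrightarrow> j \<in> P"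
    by (auto simp: distinct_conv_nth nth_mark)
  let ?\<pi> = "transpose i j"
  have \<pi>: "?\<pi> permutes {..<length w}" using ij by (intro permutes_swap_id) auto
  have "permute_list ?\<pi> w = w"
    using ij by (intro nth_equalityI) (auto simp: permute_list_def transpose_def)
  moreover have "?\<pi> ` P = P"
    using ij(5) by (auto simp: transpose_def image_iff)
  ultimately have "rel w P = - rel w P"
    using rel[OF \<pi>, of P] ij(3) by (simp add: sign_swap_id)
  then have "2 *s rel w P = 0"
    using scale_left_distrib[of 1 1 "rel w P"] by (simp add: eq_neg_iff_add_eq_0)
  then show ?thesis using subspace_0[OF W] by simp
qed

end

section \<open>Exchange and straightening relations for arbitrary words\<close>

context two_columns
begin

lemma alt_mark_permute:
  assumes "\<pi> permutes {..<length w}"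
  shows "alt (mark (permute_list \<pi> w) X @ R) = of_int (sign \<pi>) *s alt (mark w (\<pi> ` X) @ R)"
  using assms by (simp add: mark_permute alt_permute)

definition exchange_rel :: "(bool \<times> nat) list \<Rightarrow> nat \<Rightarrow> nat list \<Rightarrow> nat set \<Rightarrow> 'v" where
  "exchange_rel R k w P = alt (mark w P @ R)
     - (- 1) ^ k *s disjoint_sum {..<length w} k (\<lambda>X. alt (mark w X @ R)) P"

definition straightening_rel :: "(bool \<times> nat) list \<Rightarrow> nat \<Rightarrow> nat list \<Rightarrow> nat set \<Rightarrow> 'v" where
  "straightening_rel R k w D = upper_sum {..<length w} k (\<lambda>X. alt (mark w X @ R)) D"

lemma exchange_rel_permute:
  assumes "\<pi> permutes {..<length w}"
  shows "exchange_rel R k (permute_list \<pi> w) P = of_int (sign \<pi>) *s exchange_rel R k w (\<pi> ` P)"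
proof -
  have "disjoint_sum {..<length w} k (\<lambda>X. alt (mark (permute_list \<pi> w) X @ R)) P
      = of_int (sign \<pi>) *s disjoint_sum {..<length w} k (\<lambda>X. alt (mark w (\<pi> ` X) @ R)) P"
    using assms by (simp add: disjoint_sum_def alt_mark_permute scale_sum_right)
  also have "\<dots> = of_int (sign \<pi>) *s disjoint_sum {..<length w} k (\<lambda>X. alt (mark w X @ R)) (\<pi> ` P)"
    by (simp only: disjoint_sum_permute[OF assms, of k "\<lambda>X. alt (mark w X @ R)"])
  finally show ?thesis
    using assms by (simp add: exchange_rel_def alt_mark_permute scale_right_diff_distrib mult.commute)
qed

lemma straightening_rel_permute:
  assumes "\<pi> permutes {..<length w}"
  shows "straightening_rel R k (permute_list \<pi> w) P
    = of_int (sign \<pi>) *s straightening_rel R k w (\<pi> ` P)"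
proof -
  have "straightening_rel R k (permute_list \<pi> w) P
      = of_int (sign \<pi>) *s upper_sum {..<length w} k (\<lambda>X. alt (mark w (\<pi> ` X) @ R)) P"
    using assms by (simp add: straightening_rel_def upper_sum_def alt_mark_permute scale_sum_right)
  then show ?thesis
    by (simp only: upper_sum_permute[OF assms, of k "\<lambda>X. alt (mark w X @ R)"] straightening_rel_def)
qed

text \<open>Induction from the smallest letter \<open>s\<close>. If \<open>s\<close> goes to the
  second factor, it passes all remaining first-factor letters; these exceed \<open>s\<close>, so
  each passage accounts for one new crossing.\<close>

lemma alt_shuffle:
  assumes "sorted u" "distinct u"
  shows "alt (L @ map (\<lambda>s. (q s, s)) u @ R)
    = (- 1) ^ crossings (filter (\<lambda>s. \<not> q s) u) (filter q u) *s
      alt (L @ map (Pair False) (filter (\<lambda>s. \<not> q s) u) @ map (Pair True) (filter q u) @ R)"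
  using assms
proof (induction u arbitrary: L)
  case Nil
  then show ?case by (simp add: crossings_def)
next
  case (Cons s u)
  let ?F = "filter (\<lambda>s. \<not> q s) u" and ?T = "filter q u"
  have less: "s < t" if "t \<in> set u" for t
    using Cons.prems that by (auto simp: less_le)
  show ?case
  proof (cases "q s")
    case True
    have "crossings ?F [s] = length ?F"
    proof -
      have "crossings ?F [s] = (\<Sum>x\<leftarrow>?F. 1)"
        unfolding crossings_def using less by (intro arg_cong[where f = sum_list] map_cong) auto
      then show ?thesis by (simp add: sum_list_triv)
    qed
    then have "crossings ?F (s # ?T) = length ?F + crossings ?F ?T"
      using crossings_append_right[of ?F "[s]" ?T] by simp
    then show ?thesis
      using True Cons.prems Cons.IH[of "L @ [(True, s)]"]
        alt_move[of L "(True, s)" "map (Pair False) ?F" "map (Pair True) ?T @ R"]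
      by (simp add: power_add mult.commute)
  next
    case False
    have "crossings [s] ?T = 0"
      using less by (intro crossings_eq_0) (auto intro: less_imp_le)
    then have "crossings (s # ?F) ?T = crossings ?F ?T"
      using crossings_append_left[of "[s]" ?F ?T] by simp
    then show ?thesis
      using False Cons.prems Cons.IH[of "L @ [(False, s)]"] by simp
  qed
qed

text \<open>The comultiplication sign is exactly the sign of sorting the tags, so the sum over
  subsets of letters becomes an unsigned sum over position sets.\<close>

lemma alt_coproduct:
  assumes A: "finite A" "k \<le> card A"
  shows "(\<Sum>S\<in>{S. S \<subseteq> A \<and> card S = card A - k}. sgn2 S (A - S) *s
      alt (map (Pair False) (sorted_list_of_set S) @ map (Pair True) (sorted_list_of_set (A - S)) @ R))
    = (\<Sum>X\<in>{X. X \<subseteq> {..<card A} \<and> card X = k}. alt (mark (sorted_list_of_set A) X @ R))"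
proof -
  let ?u = "sorted_list_of_set A"
  \<comment> \<open>Here \<open>S\<close> holds the letters that stay in the first factor, so
    \<open>?pos S\<close> marks the complement.\<close>
  let ?pos = "\<lambda>S. {i. i < card A \<and> ?u ! i \<notin> S}"
  have u: "sorted ?u" "distinct ?u" "set ?u = A" "length ?u = card A" using A by auto
  have *: "sgn2 S (A - S) *s
      alt (map (Pair False) (sorted_list_of_set S) @ map (Pair True) (sorted_list_of_set (A - S)) @ R)
     = alt (mark ?u (?pos S) @ R)" if S: "S \<subseteq> A" for S
  proof -
    have "finite S" using S A finite_subset by blast
    moreover have "sorted_list_of_set S = filter (\<lambda>s. \<not> s \<notin> S) ?u"
      using u S by (intro sorted_list_of_set_eqI) (auto simp: sorted_wrt_filter)
    moreover have "sorted_list_of_set (A - S) = filter (\<lambda>s. s \<notin> S) ?u"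
      using u S by (intro sorted_list_of_set_eqI) (auto simp: sorted_wrt_filter)
    moreover have "mark ?u (?pos S) = map (\<lambda>s. (s \<notin> S, s)) ?u"
      using u by (intro nth_equalityI) (auto simp: nth_mark)
    ultimately show ?thesis
      using alt_shuffle[OF u(1,2), of "[]" "\<lambda>s. s \<notin> S" R] A
      by (simp add: sgn2_eq_crossings)
  qed
  have inj: "inj_on ((!) ?u) X" if "X \<subseteq> {..<card A}" for X
    using that u(4) nth_eq_iff_index_eq[OF u(2)] by (intro inj_onI) (metis lessThan_iff subsetD)
  have surj: "\<exists>i<card A. ?u ! i = s" if "s \<in> A" for s
    using that u by (metis in_set_conv_nth)
  have bij: "bij_betw ?pos {S. S \<subseteq> A \<and> card S = card A - k} {X. X \<subseteq> {..<card A} \<and> card X = k}"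
  proof (rule bij_betwI[where g = "\<lambda>X. A - (!) ?u ` X"])
    show "?pos \<in> {S. S \<subseteq> A \<and> card S = card A - k} \<rightarrow> {X. X \<subseteq> {..<card A} \<and> card X = k}"
    proof
      fix S assume S: "S \<in> {S. S \<subseteq> A \<and> card S = card A - k}"
      have "(!) ?u ` ?pos S = A - S"
        using u surj by (auto simp: image_iff dest: nth_mem)
      moreover have "card ((!) ?u ` ?pos S) = card (?pos S)"
        by (rule card_image[OF inj]) auto
      moreover have "card (A - S) = k"
        using S A card_Diff_subset[of S A] finite_subset[of S A] by auto
      ultimately show "?pos S \<in> {X. X \<subseteq> {..<card A} \<and> card X = k}" by auto
    qed
    show "(\<lambda>X. A - (!) ?u ` X) \<in> {X. X \<subseteq> {..<card A} \<and> card X = k} \<rightarrow> {S. S \<subseteq> A \<and> card S = card A - k}"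
    proof
      fix X assume X: "X \<in> {X. X \<subseteq> {..<card A} \<and> card X = k}"
      then have "(!) ?u ` X \<subseteq> A" using u(3,4) nth_mem[of _ ?u] by fastforce
      then have "card (A - (!) ?u ` X) = card A - card ((!) ?u ` X)"
        using A by (intro card_Diff_subset) (auto dest: finite_subset)
      then show "A - (!) ?u ` X \<in> {S. S \<subseteq> A \<and> card S = card A - k}"
        using X inj[of X] by (auto simp: card_image)
    qed
  next
    fix S assume "S \<in> {S. S \<subseteq> A \<and> card S = card A - k}"
    then show "A - (!) ?u ` ?pos S = S" using surj by fastforce
  next
    fix X assume "X \<in> {X. X \<subseteq> {..<card A} \<and> card X = k}"
    then show "?pos (A - (!) ?u ` X) = X"
      using u by (auto simp: nth_eq_iff_index_eq dest: nth_mem subsetD)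
  qed
  have "(\<Sum>S\<in>{S. S \<subseteq> A \<and> card S = card A - k}. sgn2 S (A - S) *s
      alt (map (Pair False) (sorted_list_of_set S) @ map (Pair True) (sorted_list_of_set (A - S)) @ R))
    = (\<Sum>S\<in>{S. S \<subseteq> A \<and> card S = card A - k}. alt (mark ?u (?pos S) @ R))"
    using * by (intro sum.cong refl) blast
  also have "\<dots> = (\<Sum>X\<in>{X. X \<subseteq> {..<card A} \<and> card X = k}. alt (mark ?u X @ R))"
    by (rule sum.reindex_bij_betw[OF bij])
  finally show ?thesis .
qed

section \<open>The basis relations of both maps as relations between words\<close>

definition gamma_rel :: "nat \<Rightarrow> nat set \<Rightarrow> nat set \<Rightarrow> nat set \<Rightarrow> 'v" where
  "gamma_rel k A B C =
     alt (map (Pair False) (sorted_list_of_set A) @ map (Pair True) (sorted_list_of_set B)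
       @ map (Pair True) (sorted_list_of_set C))
     - (\<Sum>S\<in>{S. S \<subseteq> A \<and> card S = card A - k}. sgn2 S (A - S) *s
         alt (map (Pair False) (sorted_list_of_set S) @ map (Pair False) (sorted_list_of_set B)
           @ map (Pair True) (sorted_list_of_set (A - S)) @ map (Pair True) (sorted_list_of_set C)))"

definition theta_rel :: "nat set \<Rightarrow> nat list \<Rightarrow> 'v" where
  "theta_rel A v = (\<Sum>S\<in>{S. S \<subseteq> A \<and> card S = card A - 1}. sgn2 S (A - S) *s
     alt (map (Pair False) (sorted_list_of_set S) @ map (Pair True) (sorted_list_of_set (A - S))
       @ map (Pair True) v))"

text \<open>The letters of \<open>B\<close> occupy the last \<open>k\<close> positions, so the
  \<open>k\<close>-sets disjoint from them are the choices made in \<open>A\<close>. Moving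
  \<open>B\<close> behind the \<open>k\<close> chosen letters, as the twist requires, produces the
  sign \<open>(- 1) ^ k\<close>.\<close>

lemma gamma_rel_eq:
  assumes fin: "finite A" "finite B" and c: "card B = k" "k \<le> card A"
  shows "gamma_rel k A B C = exchange_rel (map (Pair True) (sorted_list_of_set C)) k
    (sorted_list_of_set A @ sorted_list_of_set B) {card A..<card A + k}"
proof -
  let ?F = "map (Pair False) :: nat list \<Rightarrow> _" and ?T = "map (Pair True) :: nat list \<Rightarrow> _"
  let ?R = "?T (sorted_list_of_set C)" and ?u = "sorted_list_of_set A" and ?v = "sorted_list_of_set B"
  let ?N = "length (?u @ ?v)"
  have len: "length ?u = card A" "length ?v = k" "?N = card A + k" using fin c by auto
  have swap: "alt (?F (sorted_list_of_set S) @ ?F ?v @ ?T (sorted_list_of_set (A - S)) @ ?R)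
      = (- 1) ^ k *s alt (?F (sorted_list_of_set S) @ ?T (sorted_list_of_set (A - S)) @ ?F ?v @ ?R)"
    if S: "S \<subseteq> A" "card S = card A - k" for S
  proof -
    have "card (A - S) = k" using S fin c by (simp add: card_Diff_subset finite_subset)
    then have "length ?v * length (sorted_list_of_set (A - S)) = k * k" using len fin by simp
    moreover have "(- 1) ^ (k * k) = ((- 1) ^ k :: 'a)"
      by (cases "even k") auto
    ultimately show ?thesis
      using alt_block_swap[of "?F (sorted_list_of_set S)" "?F ?v" "?T (sorted_list_of_set (A - S))" ?R]
      by simp
  qed
  have "(\<Sum>S\<in>{S. S \<subseteq> A \<and> card S = card A - k}. sgn2 S (A - S) *s
         alt (?F (sorted_list_of_set S) @ ?F ?v @ ?T (sorted_list_of_set (A - S)) @ ?R))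
      = (- 1) ^ k *s (\<Sum>S\<in>{S. S \<subseteq> A \<and> card S = card A - k}. sgn2 S (A - S) *s
         alt (?F (sorted_list_of_set S) @ ?T (sorted_list_of_set (A - S)) @ ?F ?v @ ?R))"
    unfolding scale_sum_right using swap by (intro sum.cong refl) (simp add: mult.commute)
  also have "(\<Sum>S\<in>{S. S \<subseteq> A \<and> card S = card A - k}. sgn2 S (A - S) *s
         alt (?F (sorted_list_of_set S) @ ?T (sorted_list_of_set (A - S)) @ ?F ?v @ ?R))
      = (\<Sum>X\<in>{X. X \<subseteq> {..<card A} \<and> card X = k}. alt (mark ?u X @ ?F ?v @ ?R))"
    by (rule alt_coproduct[OF fin(1) c(2)])
  also have "\<dots> = disjoint_sum {..<?N} k (\<lambda>X. alt (mark (?u @ ?v) X @ ?R)) {card A..<card A + k}"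
    unfolding disjoint_sum_def
  proof (intro sum.cong)
    show "{X. X \<subseteq> {..<card A} \<and> card X = k}
        = {X. X \<subseteq> {..<?N} - {card A..<card A + k} \<and> card X = k}"
      using len by (auto simp: subset_iff)
    fix X assume "X \<in> {X. X \<subseteq> {..<?N} - {card A..<card A + k} \<and> card X = k}"
    then have "mark ?v {j. length ?u + j \<in> X} = ?F ?v"
      using len by (intro mark_all_False) auto
    then show "alt (mark ?u X @ ?F ?v @ ?R) = alt (mark (?u @ ?v) X @ ?R)"
      by (simp add: mark_append)
  qed
  finally have "(\<Sum>S\<in>{S. S \<subseteq> A \<and> card S = card A - k}. sgn2 S (A - S) *s
         alt (?F (sorted_list_of_set S) @ ?F ?v @ ?T (sorted_list_of_set (A - S)) @ ?R))
      = (- 1) ^ k *s disjoint_sum {..<?N} k (\<lambda>X. alt (mark (?u @ ?v) X @ ?R)) {card A..<card A + k}" .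
  moreover have "mark (?u @ ?v) {card A..<card A + k} = ?F ?u @ ?T ?v"
    unfolding mark_append by (intro arg_cong2[where f = append] mark_all_False mark_all_True)
      (use len in auto)
  ultimately show ?thesis
    by (simp add: gamma_rel_def exchange_rel_def)
qed

text \<open>The letters of \<open>v\<close> are already in the second factor, and comultiplication
  adds one letter of \<open>A\<close> to them. Any splitting \<open>v @ z\<close> is allowed, so one
  relation serves every exchange size up to one more than the number of letters.\<close>

lemma theta_rel_eq:
  assumes A: "finite A" "card A = Suc a" and k: "k = Suc (length v)"
  shows "theta_rel A (v @ z) = straightening_rel (map (Pair True) z) k
    (sorted_list_of_set A @ v) {Suc a..<Suc a + length v}"
proof -
  let ?u = "sorted_list_of_set A" and ?D = "{Suc a..<Suc a + length v}"
  let ?T = "map (Pair True) :: nat list \<Rightarrow> _"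
  have len: "length ?u = Suc a" using A by auto
  have "theta_rel A (v @ z) = (\<Sum>X\<in>{X. X \<subseteq> {..<card A} \<and> card X = 1}. alt (mark ?u X @ ?T (v @ z)))"
    unfolding theta_rel_def by (rule alt_coproduct) (use A in auto)
  also have "{X. X \<subseteq> {..<card A} \<and> card X = 1} = (\<lambda>i. {i}) ` {..<Suc a}"
    using A by (auto simp: card_1_singleton_iff)
  also have "(\<Sum>X\<in>\<dots>. alt (mark ?u X @ ?T (v @ z))) = (\<Sum>i<Suc a. alt (mark ?u {i} @ ?T (v @ z)))"
    by (subst sum.reindex) (auto simp: inj_on_def)
  also have "\<dots> = (\<Sum>i\<in>{..<length (?u @ v)} - ?D. alt (mark (?u @ v) (insert i ?D) @ ?T z))"
  proof (intro sum.cong)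
    show "{..<Suc a} = {..<length (?u @ v)} - ?D" using len by auto
    fix i assume i: "i \<in> {..<length (?u @ v)} - ?D"
    have "mark ?u (insert i ?D) = mark ?u {i}"
      using A by (intro nth_equalityI) (auto simp: nth_mark len)
    moreover have "mark v {j. length ?u + j \<in> insert i ?D} = ?T v"
      using len i by (intro mark_all_True) auto
    ultimately show "alt (mark ?u {i} @ ?T (v @ z)) = alt (mark (?u @ v) (insert i ?D) @ ?T z)"
      by (simp add: mark_append)
  qed
  also have "\<dots> = straightening_rel (?T z) k (?u @ v) ?D"
    unfolding straightening_rel_def using len k by (intro upper_sum_insert[symmetric]) auto
  finally show ?thesis .
qed

text \<open>Applies \<open>upper_sum_mem\<close> to the positions of \<open>v\<close>, of which
  there are \<open>k - 1\<close>.\<close>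

lemma theta_rel_mem:
  assumes W: "subspace W" and k: "0 < k" "k \<le> b" "k \<le> a" "k = 1 \<or> k < a"
    and gam: "\<And>A B C. A \<subseteq> {..<n} \<Longrightarrow> B \<subseteq> {..<n} \<Longrightarrow> C \<subseteq> {..<n} \<Longrightarrow>
      card A = a \<Longrightarrow> card B = k \<Longrightarrow> card C = b - k \<Longrightarrow> gamma_rel k A B C \<in> W"
    and A: "A \<subseteq> {..<n}" "card A = Suc a" and B: "B \<subseteq> {..<n}" "card B = b - 1"
  shows "theta_rel A (sorted_list_of_set B) \<in> W"
proof -
  \<comment> \<open>split \<open>e\<^sub>B\<close> into its first \<open>k - 1\<close> letters and a product \<open>z\<close> that takes no part in the exchange\<close>
  let ?e = "sorted_list_of_set B"
  have fin: "finite A" "finite B" using A B finite_subset by auto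
  have "length ?e = (k - 1) + (b - k)" using B k fin by auto
  then obtain v z where e: "?e = v @ z" and lv: "length v = k - 1" "length z = b - k"
    by (metis append_take_drop_id length_append add_diff_cancel_left' length_take min.absorb2 le_add1)
  let ?w = "sorted_list_of_set A @ v" and ?R = "map (Pair True) z :: (bool \<times> nat) list"
  have "sorted (v @ z)" "distinct (v @ z)" unfolding e[symmetric] by simp_all
  then have dz: "sorted z" "distinct z" by (simp_all add: sorted_append)
  then have z: "sorted_list_of_set (set z) = z" by (intro sorted_list_of_set_eqI) simp_all
  have "set (v @ z) \<subseteq> {..<n}" unfolding e[symmetric] using B fin by simp
  then have zn: "set z \<subseteq> {..<n}" and vn: "set v \<subseteq> {..<n}" by simp_all
  have cz: "card (set z) = b - k" using lv dz by (simp add: distinct_card)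
  have wn: "set ?w \<subseteq> {..<n}" and lw: "length ?w = a + k" using A vn fin lv k by auto
  \<comment> \<open>The given relations cover sorted blocks with a terminal position set;
    equivariance extends them to every \<open>P\<close> in the word \<open>?w\<close>.\<close>
  have ex: "exchange_rel ?R k ?w P \<in> W" if "P \<subseteq> {..<a + k}" "card P = k" for P
  proof (rule equivariant_mem[OF W exchange_rel_permute _ wn lw that])
    fix A B :: "nat set"
    assume AB: "A \<subseteq> {..<n}" "B \<subseteq> {..<n}" "card A = a" "card B = k"
    then have "finite A" "finite B" using finite_subset by auto
    with AB k gamma_rel_eq[of A B k "set z"] gam[of A B "set z"] zn cz
    show "exchange_rel ?R k (sorted_list_of_set A @ sorted_list_of_set B) {a..<a + k} \<in> W"
      by (simp add: z)
  qed
  have "theta_rel A ?e = theta_rel A (v @ z)" by (simp only: e)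
  also have "\<dots> = straightening_rel ?R k ?w {Suc a..<Suc a + length v}"
    using A fin k lv by (intro theta_rel_eq) auto
  also have "\<dots> \<in> W"
    unfolding straightening_rel_def
  proof (rule upper_sum_mem[OF W _ _ k(4)])
    fix P assume "P \<subseteq> {..<length ?w}" "card P = k"
    then show "alt (mark ?w P @ ?R)
      - (- 1) ^ k *s disjoint_sum {..<length ?w} k (\<lambda>X. alt (mark ?w X @ ?R)) P \<in> W"
      using ex[of P] lw unfolding exchange_rel_def by metis
  qed (use lw lv k in auto)
  finally show ?thesis .
qed

text \<open>Here the straightening relations are read with \<open>z\<close> empty and exchange size
  \<open>b\<close>, then specialized to keep the letters of \<open>C\<close> in the second
  factor.\<close>

lemma gamma_rel_mem:
  assumes W: "subspace W" and k: "0 < k" "k \<le> b" "k \<le> a"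
    and theta: "\<And>A B. A \<subseteq> {..<n} \<Longrightarrow> B \<subseteq> {..<n} \<Longrightarrow>
      card A = Suc a \<Longrightarrow> card B = b - 1 \<Longrightarrow> theta_rel A (sorted_list_of_set B) \<in> W"
    and A: "A \<subseteq> {..<n}" "card A = a" and B: "B \<subseteq> {..<n}" "card B = k" and C: "C \<subseteq> {..<n}" "card C = b - k"
  shows "gamma_rel k A B C \<in> W"
proof -
  let ?w = "sorted_list_of_set A @ sorted_list_of_set B" and ?z = "sorted_list_of_set C"
  let ?N = "{..<a + k}" and ?R = "map (Pair True) ?z :: (bool \<times> nat) list" and ?Z = "{a + k..<a + b}"
  have fin: "finite A" "finite B" "finite C" using A B C finite_subset[OF _ finite_lessThan] by blast+
  have lw: "length ?w = a + k" and lz: "length ?z = b - k" using A B C fin by auto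
  have lwz: "length (?w @ ?z) = a + b" using lw lz k by simp
  have st: "straightening_rel [] b w D \<in> W"
    if "set w \<subseteq> {..<n}" "length w = Suc a + (b - 1)" "D \<subseteq> {..<Suc a + (b - 1)}" "card D = b - 1" for w D
  proof (rule equivariant_mem[OF W straightening_rel_permute _ that])
    fix A B :: "nat set"
    assume AB: "A \<subseteq> {..<n}" "B \<subseteq> {..<n}" "card A = Suc a" "card B = b - 1"
    then have "finite A" "finite B" using finite_subset by auto
    with AB k theta_rel_eq[of A a b "sorted_list_of_set B" "[]"] theta[of A B]
    show "straightening_rel [] b (sorted_list_of_set A @ sorted_list_of_set B) {Suc a..<Suc a + (b - 1)} \<in> W"
      by simp
  qed
  have "alt (mark ?w {card A..<card A + k} @ ?R)
      - (- 1) ^ k *s disjoint_sum ?N k (\<lambda>X. alt (mark ?w X @ ?R)) {card A..<card A + k} \<in> W"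
  proof (rule exchange_mem[OF W])
    fix D assume D: "D \<subseteq> ?N" "Suc (card D) = k"
    have finD: "finite D" using D finite_subset by blast
    have "upper_sum ?N k (\<lambda>X. alt (mark ?w X @ ?R)) D = (\<Sum>i\<in>?N - D. alt (mark ?w (insert i D) @ ?R))"
      using D by (intro upper_sum_insert) auto
    \<comment> \<open>Absorbing the fixed suffix into the word adds its \<open>b - k\<close>
      positions \<open>?Z\<close> to \<open>D\<close>, giving a set of size \<open>b - 1\<close> as
      \<open>st\<close> demands.\<close>
    also have "\<dots> = (\<Sum>i\<in>{..<a + b} - (D \<union> ?Z). alt (mark (?w @ ?z) (insert i (D \<union> ?Z)) @ []))"
    proof (intro sum.cong)
      show "?N - D = {..<a + b} - (D \<union> ?Z)" using k by auto
      fix i assume i: "i \<in> {..<a + b} - (D \<union> ?Z)"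
      have "mark ?w (insert i (D \<union> ?Z)) = mark ?w (insert i D)"
        using lw by (intro nth_equalityI) (auto simp: nth_mark)
      moreover have "mark ?z {j. length ?w + j \<in> insert i (D \<union> ?Z)} = ?R"
        by (rule mark_all_True) (use lw lz in auto)
      ultimately show "alt (mark ?w (insert i D) @ ?R) = alt (mark (?w @ ?z) (insert i (D \<union> ?Z)) @ [])"
        by (simp only: mark_append[of ?w ?z] append_Nil2)
    qed
    also have "\<dots> = straightening_rel [] b (?w @ ?z) (D \<union> ?Z)"
    proof -
      have "card (D \<union> ?Z) = card D + card ?Z"
        using finD D by (intro card_Un_disjoint) auto
      then show ?thesis
        unfolding straightening_rel_def lwz using D k
        by (intro upper_sum_insert[symmetric]) auto
    qed
    also have "\<dots> \<in> W"
    proof (rule st)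
      have "card (D \<union> ?Z) = card D + card ?Z"
        using finD D by (intro card_Un_disjoint) auto
      then show "card (D \<union> ?Z) = b - 1" using D k by auto
    qed (use A B C fin lw lz k D in auto)
    finally show "upper_sum ?N k (\<lambda>X. alt (mark ?w X @ ?R)) D \<in> W" .
  qed (use A in auto)
  then show ?thesis
    using gamma_rel_eq[of A B k C] fin A B k lw by (simp add: exchange_rel_def)
qed

end

section \<open>Exterior powers\<close>

definition fscale :: "'a::field_char_0 \<Rightarrow> ('b \<Rightarrow> 'a) \<Rightarrow> 'b \<Rightarrow> 'a" where
  "fscale c f = (\<lambda>J. c * f J)"

lemma fscale_apply: "fscale c f J = c * f J"
  by (simp add: fscale_def)

interpretation fun_space: vector_space_char_0 fscale
  by standard (auto simp: fscale_def algebra_simps fun_eq_iff)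

lemma sum_fun_apply: "(\<Sum>i\<in>A. f i) x = (\<Sum>i\<in>A. f i x)" for f :: "'i \<Rightarrow> 'b \<Rightarrow> 'a::comm_monoid_add"
  by (induction A rule: infinite_finite_induct) auto

lemma ptensor_Cons:
  "ptensor (x # xs) J = (case J of [] \<Rightarrow> 0 | A # J' \<Rightarrow> x A * ptensor xs J')"
  by (cases J) (auto simp: ptensor_def prod.lessThan_Suc_shift simp del: prod.lessThan_Suc)

lemma ptensor_scale_pair:
  "ptensor (ps @ (\<lambda>V. c * x V) # (\<lambda>V. d * y V) # ss) = fscale (c * d) (ptensor (ps @ x # y # ss))"
proof
  show "ptensor (ps @ (\<lambda>V. c * x V) # (\<lambda>V. d * y V) # ss) J = fscale (c * d) (ptensor (ps @ x # y # ss)) J" for J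
  proof (induction ps arbitrary: J)
    case Nil
    then show ?case by (simp add: ptensor_Cons fscale_def split: list.split)
  next
    case (Cons p ps)
    then show ?case by (simp add: ptensor_Cons fscale_def split: list.split)
  qed
qed

lemma wedge_ebas:
  assumes "finite A" "finite B"
  shows "wedge (ebas A) (ebas B) = (\<lambda>V. (if A \<inter> B = {} then sgn2 A B else 0) * ebas (A \<union> B) V)"
proof
  fix V
  show "wedge (ebas A) (ebas B) V = (if A \<inter> B = {} then sgn2 A B else 0) * ebas (A \<union> B) V"
  proof (cases "finite V")
    case False
    \<comment> \<open>For infinite \<open>V\<close> the defining sum of \<open>wedge\<close> runs
      over an infinite set and is zero by convention.\<close>
    then have "V \<noteq> A \<union> B" using assms by auto
    then show ?thesis using False by (simp add: wedge_def ebas_def)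
  next
    case True
    have "wedge (ebas A) (ebas B) V
        = (\<Sum>S\<in>Pow V. if S = A then sgn2 A (V - A) * ebas B (V - A) else 0)"
      unfolding wedge_def by (intro sum.cong) (auto simp: ebas_def)
    also have "\<dots> = (if A \<subseteq> V then sgn2 A (V - A) * ebas B (V - A) else 0)"
      using True by (subst sum.delta) auto
    also have "\<dots> = (if A \<inter> B = {} then sgn2 A B else 0) * ebas (A \<union> B) V"
    proof -
      have "A \<subseteq> V \<and> V - A = B \<longleftrightarrow> A \<inter> B = {} \<and> V = A \<union> B" by auto
      then show ?thesis by (auto simp: ebas_def)
    qed
    finally show ?thesis .
  qed
qed

text \<open>Multiplying by the unit lets a lone factor be treated as a product of two.\<close>

lemma ebas_eq_wedge: "finite A \<Longrightarrow> ebas A = wedge (ebas A) (ebas {})"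
  by (simp add: wedge_ebas sgn2_def)

text \<open>Since \<open>False < True\<close>, the two columns do not cross. The remaining crossings
  give the signs of the two exterior products, and a repeated letter within a column kills both
  sides.\<close>

lemma (in two_columns) alt_columns:
  assumes fin: "finite S" "finite B" "finite D" "finite C"
  shows "alt (map (Pair False) (sorted_list_of_set S) @ map (Pair False) (sorted_list_of_set B)
      @ map (Pair True) (sorted_list_of_set D) @ map (Pair True) (sorted_list_of_set C))
    = ((if S \<inter> B = {} then sgn2 S B else 0) * (if D \<inter> C = {} then sgn2 D C else 0)) *s U (S \<union> B) (D \<union> C)"
proof -
  let ?F = "map (Pair False) :: nat list \<Rightarrow> _" and ?T = "map (Pair True) :: nat list \<Rightarrow> _"
  let ?s = "sorted_list_of_set S" and ?b = "sorted_list_of_set B"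
    and ?d = "sorted_list_of_set D" and ?c = "sorted_list_of_set C"
  let ?L = "?F ?s @ ?F ?b @ ?T ?d @ ?T ?c"
  have cr: "crossings (map (Pair p) xs) (map (Pair p) ys) = crossings xs ys" for p :: bool and xs ys :: "nat list"
    by (simp add: crossings_def filter_map o_def)
  have so: "inversions (map (Pair p) (sorted_list_of_set X)) = 0" for p :: bool and X :: "nat set"
    by (intro inversions_sorted) (simp add: sorted_map)
  have FT: "crossings (?F xs) (?T ys) = 0" for xs ys
    by (rule crossings_eq_0) auto
  have inv: "inversions ?L = crossings ?s ?b + crossings ?d ?c"
    by (simp add: inversions_append crossings_append_left crossings_append_right cr so FT)
  have dist: "distinct ?L \<longleftrightarrow> S \<inter> B = {} \<and> D \<inter> C = {}"
    using fin by (auto simp: distinct_map inj_on_def)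
  have "{i. (False, i) \<in> set ?L} = S \<union> B" "{i. (True, i) \<in> set ?L} = D \<union> C"
    using fin by auto
  then show ?thesis
    unfolding alt_def dist inv using fin by (simp add: sgn2_eq_crossings power_add)
qed

text \<open>This instantiates \<open>U\<close> of \<open>two_columns\<close>: all tensor factors
  except two adjacent ones are frozen.\<close>

definition column_pair :: "nat set list \<Rightarrow> nat set list \<Rightarrow> nat set \<Rightarrow> nat set \<Rightarrow> nat set list \<Rightarrow> 'a::field_char_0"
  where "column_pair pre suf X Y = ptensor (map ebas pre @ ebas X # ebas Y # map ebas suf)"

context
  fixes pre suf :: "nat set list"
begin

interpretation two_columns fscale "column_pair pre suf"
  by standard

lemma ptensor_wedges:
  assumes "finite S" "finite B" "finite D" "finite C"
  shows "ptensor (map ebas pre @ wedge (ebas S) (ebas B) # wedge (ebas D) (ebas C) # map ebas suf)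
    = (alt (map (Pair False) (sorted_list_of_set S) @ map (Pair False) (sorted_list_of_set B)
      @ map (Pair True) (sorted_list_of_set D) @ map (Pair True) (sorted_list_of_set C))
      :: nat set list \<Rightarrow> 'a::field_char_0)"
  unfolding alt_columns[OF assms] wedge_ebas[OF assms(1,2)] wedge_ebas[OF assms(3,4)] column_pair_def
  by (rule ptensor_scale_pair)

lemma ptensor_wedge_right:
  assumes "finite S" "finite D" "finite C"
  shows "ptensor (map ebas pre @ ebas S # wedge (ebas D) (ebas C) # map ebas suf)
    = (alt (map (Pair False) (sorted_list_of_set S)
      @ map (Pair True) (sorted_list_of_set D) @ map (Pair True) (sorted_list_of_set C))
      :: nat set list \<Rightarrow> 'a::field_char_0)"
  using ptensor_wedges[of S "{}" D C] assms by (simp flip: ebas_eq_wedge)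

text \<open>Each product of basis vectors is replaced by its tagged word, so the abstract relations
  become the actual maps.\<close>

lemma gamma_basis_eq:
  assumes "finite A" "finite B" "finite C"
  shows "gamma_basis k (length pre) (pre @ A # B # C # suf) = (gamma_rel k A B C :: nat set list \<Rightarrow> 'a::field_char_0)"
proof -
  have "finite S" if "S \<subseteq> A" for S using that assms finite_subset by blast
  then show ?thesis
    unfolding gamma_basis_def gamma_rel_def Let_def
    using assms by (intro ext) (auto simp: ptensor_wedges ptensor_wedge_right sum_fun_apply fscale_def nth_append
      intro!: sum.cong)
qed

lemma theta_basis_eq:
  assumes "finite A" "finite B"
  shows "theta_basis (length pre) (pre @ A # B # suf) = (theta_rel A (sorted_list_of_set B) :: nat set list \<Rightarrow> 'a::field_char_0)"
proof -
  have "finite S" if "S \<subseteq> A" for S using that assms finite_subset by blast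
  then show ?thesis
    unfolding theta_basis_def theta_rel_def Let_def
    using assms by (intro ext) (auto simp: ptensor_wedge_right sum_fun_apply fscale_def nth_append
      intro!: sum.cong)
qed

lemma gamma_basis_mem:
  fixes W :: "(nat set list \<Rightarrow> 'a::field_char_0) set"
  assumes W: "fun_space.subspace W" and k: "0 < k" "k \<le> b" "k \<le> a"
    and theta: "\<And>A B. A \<subseteq> {..<n} \<Longrightarrow> B \<subseteq> {..<n} \<Longrightarrow> card A = Suc a \<Longrightarrow> card B = b - 1 \<Longrightarrow>
      theta_basis (length pre) (pre @ A # B # suf) \<in> W"
    and A: "A \<subseteq> {..<n}" "card A = a" and B: "B \<subseteq> {..<n}" "card B = k" and C: "C \<subseteq> {..<n}" "card C = b - k"
  shows "gamma_basis k (length pre) (pre @ A # B # C # suf) \<in> W"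
proof -
  note finite_subset[OF _ finite_lessThan, of _ n, simp]
  show ?thesis
    using gamma_rel_mem[OF W k _ A B C] theta A(1) B(1) C(1)
    by (simp add: gamma_basis_eq theta_basis_eq)
qed

lemma theta_basis_mem:
  fixes W :: "(nat set list \<Rightarrow> 'a::field_char_0) set"
  assumes W: "fun_space.subspace W" and k: "0 < k" "k \<le> b" "k \<le> a" "k = 1 \<or> k < a"
    and gam: "\<And>A B C. A \<subseteq> {..<n} \<Longrightarrow> B \<subseteq> {..<n} \<Longrightarrow> C \<subseteq> {..<n} \<Longrightarrow>
      card A = a \<Longrightarrow> card B = k \<Longrightarrow> card C = b - k \<Longrightarrow>
      gamma_basis k (length pre) (pre @ A # B # C # suf) \<in> W"
    and A: "A \<subseteq> {..<n}" "card A = Suc a" and B: "B \<subseteq> {..<n}" "card B = b - 1"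
  shows "theta_basis (length pre) (pre @ A # B # suf) \<in> W"
proof -
  note finite_subset[OF _ finite_lessThan, of _ n, simp]
  show ?thesis
    using theta_rel_mem[OF W k _ A B] gam A(1) B(1)
    by (simp add: gamma_basis_eq theta_basis_eq)
qed

end

section \<open>Images of the sums of maps as spans of basis relations\<close>

lemma bidx_iff_list_all2:
  "I \<in> bidx n \<nu> \<longleftrightarrow> list_all2 (\<lambda>A m. A \<subseteq> {..<n} \<and> card A = m) I \<nu>"
  by (auto simp: bidx_def list_all2_conv_all_nth)

lemma finite_bidx: "finite (bidx n \<nu>)"
proof (rule finite_subset)
  show "bidx n \<nu> \<subseteq> {I. set I \<subseteq> Pow {..<n} \<and> length I = length \<nu>}"
    by (auto simp: bidx_def in_set_conv_nth) blast
qed (simp add: finite_lists_length_eq)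

lemma lin_add: "lin n \<nu> F (\<lambda>I. u I + v I) J = lin n \<nu> F u J + lin n \<nu> F v J"
  by (simp add: lin_def sum.distrib distrib_right)

lemma lin_scale: "lin n \<nu> F (\<lambda>I. a * u I) J = a * lin n \<nu> F u J"
  by (simp add: lin_def sum_distrib_left mult.assoc)

lemma lin_delta:
  assumes "I \<in> bidx n \<nu>"
  shows "lin n \<nu> F (\<lambda>I'. if I' = I then a else 0) J = a * F I J"
proof -
  have "lin n \<nu> F (\<lambda>I'. if I' = I then a else 0) J = (\<Sum>I'\<in>bidx n \<nu>. if I' = I then a * F I' J else 0)"
    unfolding lin_def by (intro sum.cong) auto
  then show ?thesis using assms finite_bidx[of n \<nu>] by simp
qed

lemma lin_image_eq_span:
  fixes F :: "nat \<Rightarrow> nat set list \<Rightarrow> nat set list \<Rightarrow> 'a::field_char_0"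
  shows "{(\<lambda>J. \<Sum>c<m. lin n (\<nu> c) (F c) (x c) J) | x. \<forall>c<m. x c \<in> tspace n (\<nu> c)}
    = fun_space.span (\<Union>c<m. F c ` bidx n (\<nu> c))" (is "?M = fun_space.span ?G")
proof
  show "?M \<subseteq> fun_space.span ?G"
  proof
    fix y assume "y \<in> ?M"
    then obtain x where y: "y = (\<lambda>J. \<Sum>c<m. lin n (\<nu> c) (F c) (x c) J)" by blast
    have "y = (\<Sum>c<m. \<Sum>I\<in>bidx n (\<nu> c). fscale (x c I) (F c I))"
      by (rule ext) (simp only: y lin_def sum_fun_apply fscale_apply)
    also have "\<dots> \<in> fun_space.span ?G"
      by (intro fun_space.span_sum fun_space.span_scale fun_space.span_base) auto
    finally show "y \<in> fun_space.span ?G" .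
  qed
  have memI: "y \<in> ?M" if "\<And>J. y J = (\<Sum>c<m. lin n (\<nu> c) (F c) (x c) J)"
    "\<And>c. c < m \<Longrightarrow> x c \<in> tspace n (\<nu> c)" for y x
    using that by (intro CollectI exI[of _ x]) auto
  show "fun_space.span ?G \<subseteq> ?M"
  proof (rule fun_space.span_minimal)
    show "?G \<subseteq> ?M"
    proof
      fix y assume "y \<in> ?G"
      then obtain c I where c: "c < m" "I \<in> bidx n (\<nu> c)" "y = F c I" by blast
      \<comment> \<open>The basis vector \<open>I\<close> placed in summand \<open>c\<close>, with
        zero in all other summands.\<close>
      let ?x = "\<lambda>c' J. if J = I then if c' = c then 1 else 0 else 0 :: 'a"
      show "y \<in> ?M"
      proof (rule memI[of _ ?x])
        fix J
        have "(\<Sum>c'<m. lin n (\<nu> c') (F c') (?x c') J) = (\<Sum>c'<m. if c' = c then F c' I J else 0)"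
        proof (intro sum.cong refl)
          fix c' show "lin n (\<nu> c') (F c') (?x c') J = (if c' = c then F c' I J else 0)"
            using lin_delta[OF c(2), of "F c" 1 J] by (cases "c' = c") (simp_all add: lin_def)
        qed
        then show "y J = (\<Sum>c'<m. lin n (\<nu> c') (F c') (?x c') J)" using c(1,3) by simp
        show "?x c' \<in> tspace n (\<nu> c')" for c'
          using c(2) by (simp add: tspace_def)
      qed
    qed
    show "fun_space.subspace ?M"
    proof (rule fun_space.subspaceI)
      show "0 \<in> ?M"
        by (rule memI[of _ "\<lambda>_ _. 0"]) (simp_all add: lin_def tspace_def)
    next
      fix y z assume "y \<in> ?M" "z \<in> ?M"
      then obtain u v where u: "y = (\<lambda>J. \<Sum>c<m. lin n (\<nu> c) (F c) (u c) J)" "\<forall>c<m. u c \<in> tspace n (\<nu> c)"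
        and v: "z = (\<lambda>J. \<Sum>c<m. lin n (\<nu> c) (F c) (v c) J)" "\<forall>c<m. v c \<in> tspace n (\<nu> c)" by blast
      show "y + z \<in> ?M"
      proof (rule memI[of _ "\<lambda>c I. u c I + v c I"])
        show "(\<lambda>I. u c I + v c I) \<in> tspace n (\<nu> c)" if "c < m" for c
        proof -
          have "u c I = 0 \<and> v c I = 0" if "I \<notin> bidx n (\<nu> c)" for I
            using u(2) v(2) that \<open>c < m\<close> unfolding tspace_def by blast
          then show ?thesis unfolding tspace_def by fastforce
        qed
      qed (simp add: u v lin_add sum.distrib)
    next
      fix a y assume "y \<in> ?M"
      then obtain u where u: "y = (\<lambda>J. \<Sum>c<m. lin n (\<nu> c) (F c) (u c) J)" "\<forall>c<m. u c \<in> tspace n (\<nu> c)"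
        by blast
      show "fscale a y \<in> ?M"
        by (rule memI[of _ "\<lambda>c I. a * u c I"])
          (use u(2) in \<open>simp_all add: u(1) lin_scale fscale_apply sum_distrib_left tspace_def\<close>)
    qed
  qed
qed

text \<open>It suffices to compare generators for one \<open>c\<close> at a time with the other
  factors fixed, taking \<open>a = \<mu> ! c\<close> and \<open>b = \<mu> ! (c+1)\<close>.\<close>

lemma gamma_image_eq_theta_image:
  fixes \<mu> k :: "nat list" and n :: nat
  assumes sorted: "sorted_wrt (\<ge>) \<mu>"
    and k: "\<forall>c<length \<mu> - 1. 0 < k ! c \<and> k ! c \<le> \<mu> ! (c+1)"
    and top: "\<forall>c<length \<mu> - 1. k ! c = \<mu> ! (c+1) \<and> 1 < k ! c \<longrightarrow> \<mu> ! c > \<mu> ! (c+1)"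
  shows "gamma_image n \<mu> k = (theta_image n \<mu> :: (nat set list \<Rightarrow> 'a::field_char_0) set)"
proof -
  let ?m = "length \<mu> - 1"
  let ?P = "\<lambda>A m. A \<subseteq> {..<n} \<and> card A = m"
  let ?G = "\<Union>c<?m. gamma_basis (k ! c) c ` bidx n (gsrc \<mu> k c) :: (nat set list \<Rightarrow> 'a) set"
  let ?T = "\<Union>c<?m. theta_basis c ` bidx n (tsrc \<mu> c) :: (nat set list \<Rightarrow> 'a) set"
  \<comment> \<open>If \<open>k ! c > 1\<close>, strictness comes either from
    \<open>k ! c < \<mu> ! (c+1)\<close> or, at equality, from the assumed descent of
    \<open>\<mu>\<close>.\<close>
  have ab: "k ! c \<le> \<mu> ! c" "k ! c = 1 \<or> k ! c < \<mu> ! c" if "c < ?m" for c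
  proof -
    have "\<mu> ! (c + 1) \<le> \<mu> ! c" using sorted that by (auto simp: sorted_wrt_iff_nth_less)
    moreover have "0 < k ! c" "k ! c \<le> \<mu> ! (c + 1)" "k ! c = \<mu> ! (c+1) \<and> 1 < k ! c \<longrightarrow> \<mu> ! c > \<mu> ! (c+1)"
      using k top that by auto
    ultimately show "k ! c \<le> \<mu> ! c" "k ! c = 1 \<or> k ! c < \<mu> ! c" by linarith+
  qed
  have "?G \<subseteq> fun_space.span ?T"
  proof
    fix y assume "y \<in> ?G"
    then obtain c I where c: "c < ?m" and I: "I \<in> bidx n (gsrc \<mu> k c)" and y: "y = gamma_basis (k ! c) c I"
      by blast
    from I obtain pre A B C suf where
      I': "I = pre @ A # B # C # suf" and len: "length pre = c"
      and ps: "list_all2 ?P pre (take c \<mu>)" "list_all2 ?P suf (drop (c+2) \<mu>)"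
      and ABC: "?P A (\<mu> ! c)" "?P B (k ! c)" "?P C (\<mu> ! (c+1) - k ! c)"
      using c by (auto simp: bidx_iff_list_all2 gsrc_def list_all2_append2 list_all2_Cons2)
    have "gamma_basis (k ! c) (length pre) (pre @ A # B # C # suf) \<in> fun_space.span ?T"
    proof (rule gamma_basis_mem[where n = n and a = "\<mu> ! c" and b = "\<mu> ! (c+1)"])
      fix A B :: "nat set" assume "A \<subseteq> {..<n}" "B \<subseteq> {..<n}" "card A = Suc (\<mu> ! c)" "card B = \<mu> ! (c+1) - 1"
      then have "pre @ A # B # suf \<in> bidx n (tsrc \<mu> c)"
        using ps by (auto simp: bidx_iff_list_all2 tsrc_def intro!: list_all2_appendI)
      then show "theta_basis (length pre) (pre @ A # B # suf) \<in> fun_space.span ?T"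
        using c len by (intro fun_space.span_base) auto
    qed (use k ab c ABC in auto)
    then show "y \<in> fun_space.span ?T" using y I' len by simp
  qed
  moreover have "?T \<subseteq> fun_space.span ?G"
  proof
    fix y assume "y \<in> ?T"
    then obtain c I where c: "c < ?m" and I: "I \<in> bidx n (tsrc \<mu> c)" and y: "y = theta_basis c I"
      by blast
    from I obtain pre A B suf where
      I': "I = pre @ A # B # suf" and len: "length pre = c"
      and ps: "list_all2 ?P pre (take c \<mu>)" "list_all2 ?P suf (drop (c+2) \<mu>)"
      and AB: "?P A (\<mu> ! c + 1)" "?P B (\<mu> ! (c+1) - 1)"
      using c by (auto simp: bidx_iff_list_all2 tsrc_def list_all2_append2 list_all2_Cons2)
    have "theta_basis (length pre) (pre @ A # B # suf) \<in> fun_space.span ?G"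
    proof (rule theta_basis_mem[where n = n and k = "k ! c" and a = "\<mu> ! c" and b = "\<mu> ! (c+1)"])
      fix A B C :: "nat set"
      assume "A \<subseteq> {..<n}" "B \<subseteq> {..<n}" "C \<subseteq> {..<n}" "card A = \<mu> ! c" "card B = k ! c"
        "card C = \<mu> ! (c+1) - k ! c"
      then have "pre @ A # B # C # suf \<in> bidx n (gsrc \<mu> k c)"
        using ps by (auto simp: bidx_iff_list_all2 gsrc_def intro!: list_all2_appendI)
      then show "gamma_basis (k ! c) (length pre) (pre @ A # B # C # suf) \<in> fun_space.span ?G"
        using c len by (intro fun_space.span_base) auto
    qed (use k ab c AB in auto)
    then show "y \<in> fun_space.span ?G" using y I' len by simp
  qed
  ultimately have "fun_space.span ?G = fun_space.span ?T"
    by (intro equalityI fun_space.span_minimal fun_space.subspace_span)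
  then show ?thesis
    unfolding gamma_image_def gamma_map_def theta_image_def lin_image_eq_span .
qed

theorem theorem5p5:
  fixes \<mu> k :: "nat list" and n :: nat
  assumes "length \<mu> \<ge> 2"
    and "sorted_wrt (\<ge>) \<mu>"
    and "\<forall>i<length \<mu>. 0 < \<mu> ! i"
    and "length k = length \<mu> - 1"
    and "\<forall>c<length \<mu> - 1. 0 < k ! c \<and> k ! c \<le> \<mu> ! (c+1)"
    and "n \<ge> sum_list \<mu>"
    and "\<forall>c<length \<mu> - 1. k ! c = \<mu> ! (c+1) \<and> 1 < k ! c \<longrightarrow> \<mu> ! c > \<mu> ! (c+1)"
  shows "G_iso_quot n \<mu> (gamma_image n \<mu> k :: (nat set list \<Rightarrow> 'a::field_char_0) set)
           (theta_image n \<mu>)"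
proof -
  \<comment> \<open>With the identity as the map, the differences in the surjectivity and
    equivariance conditions are zero.\<close>
  have zero: "(\<lambda>I. 0 :: 'a) \<in> theta_image n \<mu>"
    unfolding theta_image_def by (intro CollectI exI[of _ "\<lambda>_ _. 0"]) (auto simp: lin_def tspace_def)
  show ?thesis
    unfolding G_iso_quot_def gamma_image_eq_theta_image[OF assms(2,5,7)]
    using zero by (intro exI[of _ "\<lambda>x. x"] conjI ballI allI impI refl) (auto intro!: bexI)
qed

end
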